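(* Let $p\ge1$, $r\in\{1,2\}$ and $\sigma>0$, and let $\Psi$ be a distribution function on $\mathbb{R}$ with $$\int_{\mathbb{R}}|x|^{r-1}\sqrt{\Psi(x)(1-\Psi(x))}\,dx<\infty.$$ Let $(W_k)_{k\ge1}$ be a stationary Gaussian process with mean zero and unit variance, and for each $n$ let $\bm W=(W_1,\dots,W_n)$, $\bm Z=\Psi^{-1}\circ\Phi(\bm W)$, $\bm X=\bm Y+\sigma\bm Z\in\mathbb{R}^n$ and $$D_n=\sum_{i=1}^n\sum_{j=1}^n|\mathrm{Cov}[W_i,W_j]|.$$ Suppose $\bm\psi$ is either the deterministic or the random proxy (defined in the context), and let $\bm w=\omega(\bm\psi)$, where $\omega:\mathbb{R}\to[0,1]$ is a continuous bounded function such that $\sup_{x\in\mathbb{R}}\omega(x)|x|^r<\infty$ and $\mathbb{E}[|Z|^r\omega(Z)]>0$, with $Z$ distributed according to $\Psi$. Then, as $n\to\infty$, $$|\Sigma_r-\sigma|=O_{\mathbb P}\big(n^{-1/p}\|\bm Y\|_p+n^{-1/r}D_n^{1/(2r)}\big).$$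
   Context: $\Phi$ is the standard normal distribution function and $\Psi^{-1}(u)=\inf\{x:\Psi(x)\ge u\}$. $\bm x^{\uparrow}$ is the non-decreasing rearrangement of $\bm x\in\mathbb{R}^n$; functions of vectors are applied coordinatewise. Deterministic proxy: $\psi_k=\Psi^{-1}(k/(n+1))$, $1\le k\le n$. Random proxy: $\bm\psi=\bm\xi^{\uparrow}$, where $\bm\xi$ is an auxiliary i.i.d. sample of size $n$ with distribution function $\Psi$, generated independently of $\bm X$. The estimator $\Sigma_r$ is a minimizer over $s\in\mathbb{R}$ of $\sum_{k=1}^n w_k|X_k^{\uparrow}-s\psi_k|^r$. No assumption is made on the dependence between $\bm Y$ and $\bm Z$. $\zeta_n=O_{\mathbb P}(\beta_n)$ means that $\zeta_n/\beta_n$ is bounded in probability (tight) as $n\to\infty$ ($\beta_n$ may be random). *)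

theory Defs
  imports "HOL-Probability.Probability"
begin

abbreviation std_normal_cdf :: "real \<Rightarrow> real" where
  "std_normal_cdf \<equiv> cdf std_normal_distribution"

(* Only meaningful for 0 < u < 1: otherwise the set may be empty or unbounded below. *)
definition quantile :: "(real \<Rightarrow> real) \<Rightarrow> real \<Rightarrow> real" where
  "quantile F u = Inf {x. u \<le> F x}"

(* Vectors in R^n are functions on nat of which only the coordinates 1, ..., n matter. *)
definition increasing_rearrangement :: "nat \<Rightarrow> (nat \<Rightarrow> real) \<Rightarrow> nat \<Rightarrow> real" where
  "increasing_rearrangement n x k = sort (map x [1..<Suc n]) ! (k - 1)"

definition p_norm :: "real \<Rightarrow> nat \<Rightarrow> (nat \<Rightarrow> real) \<Rightarrow> real" where
  "p_norm p n x = (\<Sum>k=1..n. \<bar>x k\<bar> powr p) powr (1 / p)"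

definition covariance :: "'a measure \<Rightarrow> ('a \<Rightarrow> real) \<Rightarrow> ('a \<Rightarrow> real) \<Rightarrow> real" where
  "covariance M U V =
     (\<integral>x. (U x - (\<integral>y. U y \<partial>M)) * (V x - (\<integral>y. V y \<partial>M)) \<partial>M)"

(* The second disjunct is the degenerate normal law with variance zero. *)
definition gaussian_rv :: "'a measure \<Rightarrow> ('a \<Rightarrow> real) \<Rightarrow> bool" where
  "gaussian_rv M U \<longleftrightarrow>
     (\<exists>m s. s > 0 \<and> distributed M lborel U (normal_density m s)) \<or>
     (U \<in> borel_measurable M \<and> (\<exists>m. AE x in M. U x = m))"

(* Processes are indexed by k \<ge> 1; the value at index 0 is irrelevant. *)
definition gaussian_process :: "'a measure \<Rightarrow> (nat \<Rightarrow> 'a \<Rightarrow> real) \<Rightarrow> bool" where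
  "gaussian_process M W \<longleftrightarrow>
     (\<forall>I a. finite I \<and> I \<subseteq> {1..} \<longrightarrow> gaussian_rv M (\<lambda>x. \<Sum>i\<in>I. a i * W i x))"

definition stationary_process :: "'a measure \<Rightarrow> (nat \<Rightarrow> 'a \<Rightarrow> real) \<Rightarrow> bool" where
  "stationary_process M W \<longleftrightarrow>
     (\<forall>k\<ge>1. W k \<in> borel_measurable M) \<and>
     (\<forall>n h. distr M (Pi\<^sub>M {1..n} (\<lambda>_. borel)) (\<lambda>x. \<lambda>k\<in>{1..n}. W (k + h) x) =
            distr M (Pi\<^sub>M {1..n} (\<lambda>_. borel)) (\<lambda>x. \<lambda>k\<in>{1..n}. W k x))"

definition deterministic_proxy ::
    "'a measure \<Rightarrow> (real \<Rightarrow> real) \<Rightarrow> (nat \<Rightarrow> nat \<Rightarrow> 'a \<Rightarrow> real) \<Rightarrow> bool" where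
  "deterministic_proxy M F \<psi> \<longleftrightarrow>
     (\<forall>n. \<forall>k\<in>{1..n}. \<forall>x\<in>space M. \<psi> n k x = quantile F (real k / (real n + 1)))"

(* The auxiliary sample of size n may be an arbitrary one for each n; no joint law across
   different n is prescribed. *)
definition random_proxy ::
    "'a measure \<Rightarrow> (real \<Rightarrow> real) \<Rightarrow> (nat \<Rightarrow> nat \<Rightarrow> 'a \<Rightarrow> real) \<Rightarrow>
       (nat \<Rightarrow> nat \<Rightarrow> 'a \<Rightarrow> real) \<Rightarrow> bool" where
  "random_proxy M F X \<psi> \<longleftrightarrow>
     (\<exists>\<xi> :: nat \<Rightarrow> nat \<Rightarrow> 'a \<Rightarrow> real. \<forall>n.
        prob_space.indep_vars M (\<lambda>_. borel) (\<xi> n) {1..n} \<and>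
        (\<forall>k\<in>{1..n}. cdf (distr M borel (\<xi> n k)) = F) \<and>
        prob_space.indep_var M
          (Pi\<^sub>M {1..n} (\<lambda>_. borel)) (\<lambda>x. \<lambda>k\<in>{1..n}. \<xi> n k x)
          (Pi\<^sub>M {1..n} (\<lambda>_. borel)) (\<lambda>x. \<lambda>k\<in>{1..n}. X n k x) \<and>
        (\<forall>k\<in>{1..n}. \<forall>x\<in>space M.
           \<psi> n k x = increasing_rearrangement n (\<lambda>i. \<xi> n i x) k))"

(* The index n = 0 is included in tight, but finitely many indices never affect tightness
   of a sequence of laws of real random variables. *)
definition bounded_in_probability ::
    "'a measure \<Rightarrow> (nat \<Rightarrow> 'a \<Rightarrow> real) \<Rightarrow> (nat \<Rightarrow> 'a \<Rightarrow> real) \<Rightarrow> bool" where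
  "bounded_in_probability M \<zeta> \<beta> \<longleftrightarrow> tight (\<lambda>n. distr M borel (\<lambda>x. \<zeta> n x / \<beta> n x))"

end

theory Submission
  imports Defs
begin

text \<open>
  Let \<open>F\<^sub>n\<close> and \<open>G\<^sub>n\<close> be the empirical distribution functions of \<open>Z\<close> and of the proxy. Comparing the
  estimator with \<open>\<sigma>\<close> in the minimisation problem bounds \<open>\<bar>\<Sigma>\<^sub>r - \<sigma>\<bar>\<close> by a constant times
  \<open>\<parallel>Y\<parallel>\<^sub>1 / n + \<integral> \<bar>F\<^sub>n - G\<^sub>n\<bar>\<close>, as long as \<open>\<Sum> w\<^sub>k \<bar>\<psi>\<^sub>k\<bar>\<^sup>r / n\<close> stays away from \<open>0\<close>. The latter holds with
  high probability because \<open>\<omega>(x) \<bar>x\<bar>\<^sup>r\<close> is bounded below on some interval charged by \<open>\<Psi>\<close>. For \<open>r = 2\<close> it is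
  enough to use this \<open>L\<^sup>1\<close> transport distance, since the weights bound \<open>w\<^sub>k \<bar>\<psi>\<^sub>k\<bar>\<close> and
  \<open>D\<^sub>n \<le> n\<^sup>2\<close>.

  The distance is controlled through \<open>E \<bar>F\<^sub>n - \<Psi>\<bar> \<le> n\<^sup>-\<^sup>1 (2 D\<^sub>n \<Psi> (1 - \<Psi>))\<^sup>1\<^sup>/\<^sup>2\<close>, which
  rests on the inequality \<open>\<bar>P(U \<le> a, V \<le> a) - \<Phi>(a)\<^sup>2\<bar> \<le> 2 \<bar>\<rho>\<bar> \<Phi>(a) (1 - \<Phi>(a))\<close> for standard Gaussian variables
  with correlation \<open>\<rho>\<close>. Its left-hand side is the absolute value of
  \<open>\<integral> 2 \<phi>(t) (\<Phi>(\<kappa> t) - \<Phi>(t)) dt\<close> over \<open>t \<le> a\<close> with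
  \<open>\<kappa> = ((1 - \<rho>) / (1 + \<rho>))\<^sup>1\<^sup>/\<^sup>2\<close>, and the integrand is estimated by the convexity of \<open>\<Phi>\<close> on
  the negative half-line.
\<close>

section \<open>Independence via characteristic functions\<close>

text \<open>The factor \<Phi>(a) (1 - \<Phi>(a)) in the covariance bound matters: transported to
  \<Psi>, its square root must be integrable over the whole line, so a bound by |\<rho>| alone would
  not do. Gebelein's inequality gives such a bound with constant 1; the orthant computation is an
  elementary substitute, and its constant 2 only changes implied constants. The slope \<kappa> blows
  up as \<rho> tends to -1, so |\<rho>| >= 1/2 is treated apart: there the trivial bound \<Phi>(a)
  (1 - \<Phi>(a)) suffices. The threshold 1/2 fits both regimes.

  The skew integral comes from conditioning on U, which needs an independent residual; hence the
  criterion for independence by characteristic functions.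

  Since Y and Z may depend on each other arbitrarily, Y is removed pathwise: sorting is an L1
  contraction, so Y costs only its mean absolute value, and probability enters afterwards, for
  counting functions of Z and of the proxy alone. The proxy error, of order n^(-1/2), hides in
  sqrt(D_n) / n because the diagonal alone gives D_n >= n.\<close>

lemma (in prob_space) expectation_indicator_comp:
  "expectation (\<lambda>x. indicat_real B (N x)) = prob (N -` B \<inter> space M)"
proof -
  have "expectation (\<lambda>x. indicat_real B (N x)) = expectation (indicat_real (N -` B \<inter> space M))"
    by (intro Bochner_Integration.integral_cong) (auto simp: indicator_def)
  then show ?thesis by simp
qed

text \<open>Normalising \<open>f\<close> to a probability density tilts \<open>M\<close> to a
  measure under which, by \<open>ch\<close>, the variable \<open>N\<close> keeps its characteristic
  function, hence its law. If \<open>f\<close> has mean zero it vanishes almost surely and there is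
  nothing to normalise.\<close>

lemma (in prob_space) weighted_law_eqI:
  fixes f N :: "'a \<Rightarrow> real"
  assumes [measurable]: "f \<in> borel_measurable M" "N \<in> borel_measurable M"
    and f: "\<And>x. 0 \<le> f x" "\<And>x. f x \<le> C"
    and ch: "\<And>t. (CLINT x|M. complex_of_real (f x) * iexp (t * N x)) =
      complex_of_real (expectation f) * char (distr M borel N) t"
    and B [measurable]: "B \<in> sets borel"
  shows "expectation (\<lambda>x. f x * indicator B (N x)) = expectation f * prob (N -` B \<inter> space M)"
proof -
  have intf: "integrable M f"
    using f by (intro integrable_const_bound[where B = C]) auto
  show ?thesis
  proof (cases "expectation f = 0")
    case True
    then have "AE x in M. f x = 0"
      using integral_nonneg_eq_0_iff_AE[OF intf] f by auto
    then have "expectation (\<lambda>x. f x * indicator B (N x)) = 0"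
      by (intro integral_eq_zero_AE) auto
    with True show ?thesis by simp
  next
    case False
    with f have pos: "expectation f > 0"
      by (smt (verit) Bochner_Integration.integral_nonneg)
    define g where "g x = f x / expectation f" for x
    have g0: "0 \<le> g x" for x using f pos by (simp add: g_def)
    have [measurable]: "g \<in> borel_measurable M" unfolding g_def by measurable
    have intg: "integrable M g" unfolding g_def using intf by simp
    have "expectation g = 1" unfolding g_def using False by simp
    define Q where "Q = density M (\<lambda>x. ennreal (g x))"
    have setsQ [measurable_cong]: "sets Q = sets M" by (simp add: Q_def)
    interpret Q: prob_space Q
    proof
      have "emeasure Q (space Q) = (\<integral>\<^sup>+x. ennreal (g x) \<partial>M)"
        unfolding Q_def by (subst emeasure_density) (auto intro!: nn_integral_cong)
      also have "\<dots> = 1"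
        using \<open>expectation g = 1\<close> nn_integral_eq_integral[OF intg] g0 by simp
      finally show "emeasure Q (space Q) = 1" .
    qed
    have "distr Q borel N = distr M borel N"
    proof (rule Levy_uniqueness)
      show "real_distribution (distr Q borel N)" by (rule Q.real_distribution_distr) measurable
      show "real_distribution (distr M borel N)" by (rule real_distribution_distr) measurable
      show "char (distr Q borel N) = char (distr M borel N)"
      proof
        fix t
        have "char (distr Q borel N) t = (CLINT x|Q. iexp (t * N x))"
          unfolding char_def by (subst integral_distr) measurable
        also have "\<dots> = (CLINT x|M. g x *\<^sub>R iexp (t * N x))"
          unfolding Q_def using g0 by (subst integral_density) auto
        also have "\<dots> = (CLINT x|M. complex_of_real (f x) * iexp (t * N x)) / complex_of_real (expectation f)"
          by (subst integral_divide_zero[symmetric], intro Bochner_Integration.integral_cong)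
            (auto simp: g_def scaleR_conv_of_real)
        also have "\<dots> = char (distr M borel N) t" using ch[of t] False by simp
        finally show "char (distr Q borel N) t = char (distr M borel N) t" .
      qed
    qed
    then have "integral\<^sup>L (distr Q borel N) (indicator B) = integral\<^sup>L (distr M borel N) (indicator B :: real \<Rightarrow> real)"
      by simp
    then have "(\<integral>x. indicator B (N x) \<partial>Q) = expectation (\<lambda>x. indicator B (N x) :: real)"
      by (subst (asm) (1 2) integral_distr) (auto)
    also have "(\<integral>x. indicator B (N x) \<partial>Q) = expectation (\<lambda>x. g x *\<^sub>R (indicator B (N x) :: real))"
      unfolding Q_def using g0 by (subst integral_density) auto
    also have "\<dots> = expectation (\<lambda>x. f x * indicator B (N x)) / expectation f"
      by (subst integral_divide_zero[symmetric], intro Bochner_Integration.integral_cong)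
        (auto simp: g_def)
    finally show ?thesis using False expectation_indicator_comp by (simp add: field_simps)
  qed
qed

text \<open>Uniqueness in one dimension is used twice through \<open>weighted_law_eqI\<close>. With
  weights that are trigonometric in \<open>U\<close>, the exponential of \<open>N\<close> is
  replaced by an indicator of \<open>B\<close>; this indicator then serves as the weight, and the
  exponential of \<open>U\<close> is replaced by an indicator of \<open>A\<close>.\<close>

theorem (in prob_space) indep_varI_char:
  fixes U N :: "'a \<Rightarrow> real"
  assumes [measurable]: "U \<in> borel_measurable M" "N \<in> borel_measurable M"
    and ch: "\<And>s t. (CLINT x|M. iexp (s * U x + t * N x)) =
      char (distr M borel U) s * char (distr M borel N) t"
  shows "indep_var borel U borel N"
proof -
  have bi: "integrable M (\<lambda>x. iexp (h x))" if [measurable]: "h \<in> borel_measurable M" for h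
    by (rule integrable_iexp) auto
  have chU: "char (distr M borel U) s = (CLINT x|M. iexp (s * U x))" for s
    unfolding char_def by (subst integral_distr) auto
  \<comment> \<open>Only nonnegative weights can be normalised to probabilities, so the trigonometric
    functions of \<open>U\<close> are shifted by \<open>2\<close>.\<close>
  have trig: "expectation (\<lambda>x. (2 + cos (s * U x + c)) * indicator B (N x)) =
      expectation (\<lambda>x. 2 + cos (s * U x + c)) * prob (N -` B \<inter> space M)"
    if B: "B \<in> sets borel" for s c B
  proof (rule weighted_law_eqI[where C = 3, OF _ _ _ _ _ B])
    show "0 \<le> 2 + cos (s * U x + c)" for x using cos_ge_minus_one[of "s * U x + c"] by linarith
    show "2 + cos (s * U x + c) \<le> 3" for x using cos_le_one[of "s * U x + c"] by linarith
    fix t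
    have cosE: "complex_of_real (cos y) = (iexp y + iexp (- y)) / 2" for y :: real
      by (simp add: complex_eq_iff Re_exp Im_exp)
    have pt: "complex_of_real (2 + cos (s * U x + c)) * iexp (t * N x) =
        2 * iexp (0 * U x + t * N x) + (iexp c / 2) * iexp (s * U x + t * N x) +
        (iexp (-c) / 2) * iexp ((-s) * U x + t * N x)" for x t
      by (simp only: of_real_add cosE)
        (simp add: algebra_simps exp_add[symmetric] add_divide_distrib)
    \<comment> \<open>The bracket does not depend on \<open>t\<close>. Taking \<open>t = 0\<close>
      identifies it with the expectation of the weight, which is what
      \<open>weighted_law_eqI\<close> asks for.\<close>
    have gen: "(CLINT x|M. complex_of_real (2 + cos (s * U x + c)) * iexp (t * N x)) =
       (2 + (iexp c / 2) * char (distr M borel U) s + (iexp (-c) / 2) * char (distr M borel U) (-s))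
        * char (distr M borel N) t" for t
    proof -
      have "(CLINT x|M. complex_of_real (2 + cos (s * U x + c)) * iexp (t * N x)) =
        2 * (CLINT x|M. iexp (0 * U x + t * N x)) + (iexp c / 2) * (CLINT x|M. iexp (s * U x + t * N x)) +
        (iexp (-c) / 2) * (CLINT x|M. iexp ((-s) * U x + t * N x))"
        unfolding pt
        by (subst Bochner_Integration.integral_add, (intro Bochner_Integration.integrable_add integrable_mult_right bi; measurable)+)+
           (simp only: integral_mult_right_zero)
      also have "char (distr M borel U) 0 = 1"
        by (rule real_distribution.char_zero) (rule real_distribution_distr, measurable)
      then have "(CLINT x|M. iexp (0 * U x + t * N x)) = char (distr M borel N) t"
        by (simp only: ch mult_1)
      finally show ?thesis by (simp only: ch) (simp add: algebra_simps)
    qed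
    have N0: "char (distr M borel N) 0 = 1"
      by (rule real_distribution.char_zero) (rule real_distribution_distr, measurable)
    have "complex_of_real (expectation (\<lambda>x. 2 + cos (s * U x + c))) =
      (CLINT x|M. complex_of_real (2 + cos (s * U x + c)) * iexp (0 * N x))"
      by (subst integral_complex_of_real[symmetric]) simp
    then show "(CLINT x|M. complex_of_real (2 + cos (s * U x + c)) * iexp (t * N x)) =
      complex_of_real (expectation (\<lambda>x. 2 + cos (s * U x + c))) * char (distr M borel N) t"
      by (simp only: gen N0 mult_1_right)
  qed measurable
  have cosB: "expectation (\<lambda>x. cos (s * U x + c) * indicator B (N x)) =
      expectation (\<lambda>x. cos (s * U x + c)) * prob (N -` B \<inter> space M)"
    if B [measurable]: "B \<in> sets borel" for s c B
  proof -
    have i1: "integrable M (\<lambda>x. indicator B (N x) :: real)"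
      by (intro integrable_const_bound[where B = 1]) auto
    have i2: "integrable M (\<lambda>x. cos (s * U x + c))"
      by (intro integrable_const_bound[where B = 1]) auto
    have i3: "integrable M (\<lambda>x. cos (s * U x + c) * indicator B (N x))"
      by (intro integrable_const_bound[where B = 1]) (auto simp: indicator_def)
    show ?thesis
      using trig[OF B, of s c] i1 i2 i3 by (simp add: distrib_right expectation_indicator_comp prob_space)
  qed
  have main: "prob (N -` B \<inter> space M \<inter> (U -` A \<inter> space M)) =
      prob (N -` B \<inter> space M) * prob (U -` A \<inter> space M)"
    if A [measurable]: "A \<in> sets borel" and B [measurable]: "B \<in> sets borel" for A B
  proof -
    have "expectation (\<lambda>x. indicator B (N x) * indicator A (U x)) =
      expectation (\<lambda>x. indicator B (N x)) * prob (U -` A \<inter> space M)"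
    proof (rule weighted_law_eqI[where C = 1, OF _ _ _ _ _ A])
      fix t
      have ii: "integrable M (\<lambda>x. complex_of_real (indicator B (N x)) * iexp (t * U x))"
        by (intro integrable_const_bound[where B = 1]) (auto simp: indicator_def)
      show "(CLINT x|M. complex_of_real (indicator B (N x)) * iexp (t * U x)) =
        complex_of_real (expectation (\<lambda>x. indicator B (N x))) * char (distr M borel U) t"
      proof (rule complex_eqI)
        have "Re (CLINT x|M. complex_of_real (indicator B (N x)) * iexp (t * U x)) =
          expectation (\<lambda>x. cos (t * U x + 0) * indicator B (N x))"
          by (subst integral_Re[OF ii, symmetric]) (auto simp: Re_exp mult.commute)
        also have "\<dots> = prob (N -` B \<inter> space M) * Re (CLINT x|M. iexp (t * U x))"
          by (subst cosB[OF B], subst integral_Re[symmetric], rule bi) (auto simp: Re_exp)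
        finally show "Re (CLINT x|M. complex_of_real (indicator B (N x)) * iexp (t * U x)) =
          Re (complex_of_real (expectation (\<lambda>x. indicator B (N x))) * char (distr M borel U) t)"
          by (simp add: chU expectation_indicator_comp)
        \<comment> \<open>The phase \<open>c\<close> in \<open>cosB\<close> pays off here:
          \<open>c = 0\<close> yields the real part and \<open>c = - pi / 2\<close> the imaginary
          part.\<close>
        have sc: "sin y = cos (y + (- pi / 2))" for y :: real
          using cos_diff[of y "pi / 2"]
          by simp
        have "Im (CLINT x|M. complex_of_real (indicator B (N x)) * iexp (t * U x)) =
          expectation (\<lambda>x. cos (t * U x + (- pi / 2)) * indicator B (N x))"
          by (subst integral_Im[OF ii, symmetric]) (auto simp: Im_exp mult.commute sc)
        also have "\<dots> = prob (N -` B \<inter> space M) * Im (CLINT x|M. iexp (t * U x))"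
          by (subst cosB[OF B], subst integral_Im[symmetric], rule bi) (auto simp: Im_exp sc)
        finally show "Im (CLINT x|M. complex_of_real (indicator B (N x)) * iexp (t * U x)) =
          Im (complex_of_real (expectation (\<lambda>x. indicator B (N x))) * char (distr M borel U) t)"
          by (simp add: chU expectation_indicator_comp)
      qed
    qed auto
    moreover have "expectation (\<lambda>x. indicator B (N x) * indicator A (U x) :: real) =
      expectation (indicator (N -` B \<inter> space M \<inter> (U -` A \<inter> space M)))"
      by (intro Bochner_Integration.integral_cong) (auto simp: indicator_def)
    ultimately show ?thesis using expectation_indicator_comp[of B N] by simp
  qed
  have XY: "(\<lambda>x. (U x, N x)) \<in> measurable M (borel \<Otimes>\<^sub>M borel)" by measurable
  show ?thesis
    unfolding indep_var_distribution_eq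
  proof (safe, goal_cases)
    case 3
    interpret X: prob_space "distr M borel U" by (rule prob_space_distr) measurable
    interpret Y: prob_space "distr M borel N" by (rule prob_space_distr) measurable
    interpret XY: pair_prob_space "distr M borel U" "distr M borel N" by standard
    show ?case
    proof (rule pair_measure_eqI)
      show "sigma_finite_measure (distr M borel U)" "sigma_finite_measure (distr M borel N)"
        by unfold_locales
      fix A B assume A: "A \<in> sets (distr M borel U)" and B: "B \<in> sets (distr M borel N)"
      have "emeasure (distr M (borel \<Otimes>\<^sub>M borel) (\<lambda>x. (U x, N x))) (A \<times> B) =
        emeasure M (N -` B \<inter> space M \<inter> (U -` A \<inter> space M))"
        using A B XY by (subst emeasure_distr) (auto intro!: arg_cong[where f = "emeasure M"])
      also have "\<dots> = emeasure M (U -` A \<inter> space M) * emeasure M (N -` B \<inter> space M)"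
        using main[of A B] A B by (simp add: emeasure_eq_measure ennreal_mult[symmetric] mult.commute)
      finally show "emeasure (distr M borel U) A * emeasure (distr M borel N) B =
        emeasure (distr M (borel \<Otimes>\<^sub>M borel) (\<lambda>x. (U x, N x))) (A \<times> B)"
        using A B by (simp add: emeasure_distr)
    qed simp
  qed measurable
qed

section \<open>The standard normal distribution function\<close>

lemma std_normal_cdf_diff:
  assumes "a \<le> b"
  shows "std_normal_cdf b - std_normal_cdf a = integral {a..b} std_normal_density"
proof -
  interpret real_distribution std_normal_distribution by (rule real_dist_normal_dist)
  have cont: "continuous_on {a..b} std_normal_density"
    unfolding normal_density_def by (intro continuous_intros) auto
  have "set_integrable lborel {a..b} std_normal_density"
    by (rule borel_integrable_atLeastAtMost') (rule cont)
  then have eq: "(LINT x:{a..b}|lborel. std_normal_density x) = integral {a..b} std_normal_density"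
    by (rule set_borel_integral_eq_integral)
  show ?thesis
  proof (cases "a = b")
    case False
    with assms have "a < b" by simp
    have "std_normal_cdf b - std_normal_cdf a = measure std_normal_distribution {a<..b}"
      using finite_borel_measure.cdf_diff_eq[OF finite_borel_measure_M \<open>a < b\<close>] .
    also have "\<dots> = enn2real (\<integral>\<^sup>+x. ennreal (std_normal_density x) * indicator {a<..b} x \<partial>lborel)"
      unfolding measure_def by (subst emeasure_density) auto
    also have "(\<integral>\<^sup>+x. ennreal (std_normal_density x) * indicator {a<..b} x \<partial>lborel) =
      (\<integral>\<^sup>+x. ennreal (std_normal_density x) * indicator {a..b} x \<partial>lborel)"
    proof (rule nn_integral_cong_AE)
      show "AE x in lborel. ennreal (std_normal_density x) * indicator {a<..b} x =
          ennreal (std_normal_density x) * indicator {a..b} x"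
        using AE_lborel_singleton[of a] by eventually_elim (auto simp: indicator_def)
    qed
    also have "\<dots> = (\<integral>\<^sup>+x. ennreal (indicator {a..b} x *\<^sub>R std_normal_density x) \<partial>lborel)"
      by (intro nn_integral_cong) (auto simp: indicator_def)
    also have "enn2real \<dots> = (LINT x:{a..b}|lborel. std_normal_density x)"
      unfolding set_lebesgue_integral_def
      by (subst integral_eq_nn_integral) (auto simp: indicator_def)
    finally show ?thesis using eq by simp
  qed simp
qed

lemma DERIV_std_normal_cdf:
  "(std_normal_cdf has_real_derivative std_normal_density x) (at x)"
proof -
  have "continuous_on {x - 1..x + 1} std_normal_density"
    unfolding normal_density_def by (intro continuous_intros) auto
  then have "((\<lambda>u. integral {x - 1..u} std_normal_density) has_real_derivative std_normal_density x)
      (at x within {x - 1..x + 1})"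
    by (rule integral_has_real_derivative) auto
  then have "((\<lambda>u. integral {x - 1..u} std_normal_density) has_real_derivative std_normal_density x) (at x)"
    by (simp add: at_within_Icc_at)
  then have "((\<lambda>u. std_normal_cdf (x - 1) + integral {x - 1..u} std_normal_density)
      has_real_derivative std_normal_density x) (at x)"
    by (auto intro!: derivative_eq_intros)
  moreover have "eventually (\<lambda>u. std_normal_cdf (x - 1) + integral {x - 1..u} std_normal_density = std_normal_cdf u) (nhds x)"
    using eventually_nhds_in_open[of "{x - 1<..}" x]
    by (auto elim!: eventually_mono simp: std_normal_cdf_diff[symmetric])
  ultimately show ?thesis
    by (rule DERIV_cong_ev[THEN iffD1, rotated -1, OF _ refl _ refl])
qed

lemma std_normal_cdf_strict_mono: "strict_mono std_normal_cdf"
proof (rule strict_monoI)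
  fix x y :: real assume "x < y"
  then show "std_normal_cdf x < std_normal_cdf y"
    by (rule DERIV_pos_imp_increasing)
      (use DERIV_std_normal_cdf normal_density_pos[OF zero_less_one] in blast)
qed

lemma std_normal_cdf_pos: "0 < std_normal_cdf x"
proof -
  interpret real_distribution std_normal_distribution by (rule real_dist_normal_dist)
  have "0 \<le> std_normal_cdf (x - 1)"
    by (rule finite_borel_measure.cdf_nonneg[OF finite_borel_measure_M])
  also have "\<dots> < std_normal_cdf x" by (rule strict_monoD[OF std_normal_cdf_strict_mono]) simp
  finally show ?thesis .
qed

lemma std_normal_cdf_less_1: "std_normal_cdf x < 1"
proof -
  interpret real_distribution std_normal_distribution by (rule real_dist_normal_dist)
  have "std_normal_cdf x < std_normal_cdf (x + 1)"
    by (rule strict_monoD[OF std_normal_cdf_strict_mono]) simp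
  also have "\<dots> \<le> 1" by (rule cdf_bounded_prob)
  finally show ?thesis .
qed

lemma continuous_std_normal_cdf: "continuous_on A std_normal_cdf"
  by (rule continuous_at_imp_continuous_on, rule ballI, rule DERIV_isCont, rule DERIV_std_normal_cdf)

lemma std_normal_atomless: "measure std_normal_distribution {x} = 0"
proof -
  interpret real_distribution std_normal_distribution by (rule real_dist_normal_dist)
  have "isCont std_normal_cdf x"
    by (rule DERIV_isCont, rule DERIV_std_normal_cdf)
  moreover have "isCont std_normal_cdf x \<longleftrightarrow> measure std_normal_distribution {x} = 0"
    by (rule finite_borel_measure.isCont_cdf[OF finite_borel_measure_M])
  ultimately show ?thesis by (rule rev_iffD1)
qed

lemma std_normal_cdf_surj:
  assumes "0 < u" "u < 1"
  obtains a where "std_normal_cdf a = u"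
proof -
  interpret real_distribution std_normal_distribution by (rule real_dist_normal_dist)
  have "eventually (\<lambda>x. std_normal_cdf x < u) at_bot"
    using finite_borel_measure.cdf_lim_at_bot[OF finite_borel_measure_M] assms(1)
    by (rule order_tendstoD)
  then obtain x where x: "std_normal_cdf x < u" by (force simp: eventually_at_bot_linorder)
  have "eventually (\<lambda>x. u < std_normal_cdf x) at_top"
    using cdf_lim_at_top_prob assms(2) by (rule order_tendstoD)
  then obtain y where y: "u < std_normal_cdf y" by (force simp: eventually_at_top_linorder)
  have "x \<le> y"
    using order_less_trans[OF x y] strict_mono_less[OF std_normal_cdf_strict_mono] by simp
  then show thesis
    using IVT'[of std_normal_cdf x u y, OF _ _ _ continuous_std_normal_cdf] x y that by auto
qed

lemma std_normal_density_minus: "std_normal_density (- x) = std_normal_density x"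
  by (simp add: normal_density_def)

text \<open>The sum of the two values has derivative zero because the density is even; its constant
  value is read off in the limit at infinity.\<close>

lemma std_normal_cdf_minus: "std_normal_cdf (- x) = 1 - std_normal_cdf x"
proof -
  interpret real_distribution std_normal_distribution by (rule real_dist_normal_dist)
  have d: "((\<lambda>x. std_normal_cdf x + std_normal_cdf (- x)) has_real_derivative 0) (at x)" for x
  proof -
    have "((\<lambda>x. std_normal_cdf x + std_normal_cdf (- x)) has_real_derivative
       std_normal_density x + std_normal_density (- x) * (- 1)) (at x)"
      by (intro DERIV_add DERIV_std_normal_cdf DERIV_chain'[where g = std_normal_cdf, unfolded comp_def])
        (auto intro!: derivative_eq_intros)
    then show ?thesis by (simp add: std_normal_density_minus)
  qed
  have const: "std_normal_cdf x + std_normal_cdf (- x) = std_normal_cdf y + std_normal_cdf (- y)" for x y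
    by (rule DERIV_isconst_all) (use d in auto)
  have "((\<lambda>y. std_normal_cdf y + std_normal_cdf (- y)) \<longlongrightarrow> 1 + 0) at_top"
    by (intro tendsto_add cdf_lim_at_top_prob
        filterlim_compose[OF finite_borel_measure.cdf_lim_at_bot[OF finite_borel_measure_M]
          filterlim_uminus_at_bot_at_top])
  also have "(\<lambda>y. std_normal_cdf y + std_normal_cdf (- y)) = (\<lambda>y. std_normal_cdf x + std_normal_cdf (- x))"
    using const by (intro ext)
  finally have "((\<lambda>y::real. std_normal_cdf x + std_normal_cdf (- x)) \<longlongrightarrow> 1 + 0) at_top" .
  then show ?thesis by (simp add: tendsto_const_iff)
qed

lemma std_normal_cdf_0: "std_normal_cdf 0 = 1 / 2"
proof -
  have "std_normal_cdf (- 0) = 1 - std_normal_cdf 0" by (rule std_normal_cdf_minus)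
  then show ?thesis unfolding minus_zero by linarith
qed

lemma std_normal_density_mono_nonpos:
  "x \<le> y \<Longrightarrow> y \<le> 0 \<Longrightarrow> std_normal_density x \<le> std_normal_density y"
  using abs_le_square_iff[of y x] by (auto simp: std_normal_density_def divide_right_mono)

lemma std_normal_cdf_convex: "convex_on {..0} std_normal_cdf"
  by (rule convex_on_realI[where f' = std_normal_density])
    (auto intro: DERIV_std_normal_cdf std_normal_density_mono_nonpos convex_real_interval)

lemma std_normal_cdf_scale_le:
  assumes "t \<le> 0" "0 \<le> l" "l \<le> 1"
  shows "std_normal_cdf (l * t) \<le> l * std_normal_cdf t + (1 - l) / 2"
  using convex_onD[OF std_normal_cdf_convex, of l 0 t] assms
  by (simp add: std_normal_cdf_0 algebra_simps)

text \<open>For \<kappa> at most 1 this is the chord between \<open>t\<close> and 0, where \<Phi>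
  equals 1/2. For larger \<kappa> the same chord inequality is applied at the point
  \<open>\<kappa> * t\<close> with factor \<open>1 / \<kappa>\<close>, which leads back to
  \<open>t\<close>.\<close>

lemma std_normal_cdf_scale_diff:
  assumes "t \<le> 0" "0 < \<kappa>"
  shows "\<bar>std_normal_cdf (\<kappa> * t) - std_normal_cdf t\<bar> \<le> \<bar>\<kappa> - 1\<bar> * (1 / 2 - std_normal_cdf t)"
proof (cases "\<kappa> \<le> 1")
  case True
  have "t \<le> \<kappa> * t" using mult_right_mono_neg[OF True \<open>t \<le> 0\<close>] by simp
  then have "std_normal_cdf t \<le> std_normal_cdf (\<kappa> * t)"
    using std_normal_cdf_strict_mono by (simp add: strict_mono_less_eq)
  then show ?thesis using std_normal_cdf_scale_le[of t \<kappa>] assms True by (simp add: algebra_simps)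
next
  case False
  have "\<kappa> * t \<le> t" using mult_right_mono_neg[of 1 \<kappa> t] False assms by simp
  then have m: "std_normal_cdf (\<kappa> * t) \<le> std_normal_cdf t"
    using std_normal_cdf_strict_mono by (simp add: strict_mono_less_eq)
  have "std_normal_cdf (1 / \<kappa> * (\<kappa> * t)) \<le> 1 / \<kappa> * std_normal_cdf (\<kappa> * t) + (1 - 1 / \<kappa>) / 2"
    using False assms \<open>\<kappa> * t \<le> t\<close> by (intro std_normal_cdf_scale_le) auto
  then have "\<kappa> * std_normal_cdf t \<le> std_normal_cdf (\<kappa> * t) + (\<kappa> - 1) / 2"
    using False by (simp add: divide_simps) (simp add: algebra_simps)
  then show ?thesis using m False by (simp add: algebra_simps)
qed

text \<open>The antiderivative is half the square of \<Phi>. The half-line is reflected first, since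
  \<open>nn_integral_FTC_atLeast\<close> integrates up to plus infinity. This is the skew integral
  for \<kappa> = 1, the independent case.\<close>

lemma integral_std_normal_cdf_atMost:
  "(\<integral>u. indicator {..a} u * std_normal_cdf u \<partial>std_normal_distribution) = (std_normal_cdf a)\<^sup>2 / 2"
proof -
  interpret real_distribution std_normal_distribution by (rule real_dist_normal_dist)
  have mcdf [measurable]: "std_normal_cdf \<in> borel_measurable borel"
    by (intro borel_measurable_continuous_onI continuous_std_normal_cdf)
  have pos: "0 \<le> std_normal_cdf u" for u using std_normal_cdf_pos[of u] by simp
  have "(\<integral>\<^sup>+u. ennreal (indicator {..a} u * std_normal_cdf u) \<partial>std_normal_distribution) =
     (\<integral>\<^sup>+u. ennreal (std_normal_density u * std_normal_cdf u) * indicator {..a} u \<partial>lborel)"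
    by (subst nn_integral_density)
      (auto intro!: nn_integral_cong simp: indicator_def ennreal_mult' pos)
  also have "\<dots> = (\<integral>\<^sup>+u. ennreal (std_normal_density (- u) * std_normal_cdf (- u)) * indicator {..a} (- u) \<partial>lborel)"
    using nn_integral_real_affine[of "\<lambda>u. ennreal (std_normal_density u * std_normal_cdf u) * indicator {..a} u" "-1" 0]
    by simp
  also have "\<dots> = (\<integral>\<^sup>+u. ennreal (std_normal_density u * (1 - std_normal_cdf u)) * indicator {- a..} u \<partial>lborel)"
    by (intro nn_integral_cong) (auto simp: indicator_def std_normal_cdf_minus std_normal_density_minus )
  also have "\<dots> = ennreal (0 - (- ((1 - std_normal_cdf (- a))\<^sup>2 / 2)))"
  proof (rule nn_integral_FTC_atLeast)
    show "((\<lambda>u. - ((1 - std_normal_cdf u)\<^sup>2 / 2)) has_real_derivative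
        std_normal_density u * (1 - std_normal_cdf u)) (at u)" for u
    proof -
      have "((\<lambda>u. 1 - std_normal_cdf u) has_real_derivative 0 - std_normal_density u) (at u)"
        by (intro DERIV_diff DERIV_const DERIV_std_normal_cdf)
      from DERIV_minus[OF DERIV_cdivide[OF DERIV_power[OF this, of 2], of 2]]
      show ?thesis by (rule DERIV_cong) simp
    qed
    show "0 \<le> std_normal_density u * (1 - std_normal_cdf u)" for u
      using std_normal_cdf_less_1[of u] by simp
    have "((\<lambda>u. - ((1 - std_normal_cdf u)\<^sup>2 / 2)) \<longlongrightarrow> - ((1 - 1)\<^sup>2 / 2)) at_top"
      by (rule tendsto_minus[OF tendsto_divide[OF tendsto_power[OF tendsto_diff[OF tendsto_const cdf_lim_at_top_prob]] tendsto_const]]) simp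
    then show "((\<lambda>u. - ((1 - std_normal_cdf u)\<^sup>2 / 2)) \<longlongrightarrow> 0) at_top" by simp
  qed auto
  finally have "(\<integral>\<^sup>+u. ennreal (indicator {..a} u * std_normal_cdf u) \<partial>std_normal_distribution) =
    ennreal ((std_normal_cdf a)\<^sup>2 / 2)"
    by (simp add: std_normal_cdf_minus)
  then show ?thesis
    by (subst integral_eq_nn_integral) (auto simp: pos)
qed

text \<open>The case \<kappa> = 1 is subtracted under the integral. The factor
  \<open>1 / 2 - std_normal_cdf u\<close> left by the chord bound integrates over
  \<open>{..a}\<close> to half of \<open>std_normal_cdf a * (1 - std_normal_cdf a)\<close>, which is
  how the variance of the indicator appears.\<close>

lemma std_normal_skew_integral_bound:
  assumes "a \<le> 0" "0 < \<kappa>"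
  shows "\<bar>2 * (\<integral>u. indicator {..a} u * std_normal_cdf (\<kappa> * u) \<partial>std_normal_distribution) - (std_normal_cdf a)\<^sup>2\<bar>
    \<le> \<bar>\<kappa> - 1\<bar> * (std_normal_cdf a * (1 - std_normal_cdf a))"
proof -
  interpret real_distribution std_normal_distribution by (rule real_dist_normal_dist)
  let ?\<mu> = std_normal_distribution
  have mcdf [measurable]: "std_normal_cdf \<in> borel_measurable borel"
    by (intro borel_measurable_continuous_onI continuous_std_normal_cdf)
  have b: "\<bar>std_normal_cdf u\<bar> \<le> 1" for u
    using std_normal_cdf_pos[of u] std_normal_cdf_less_1[of u] by simp
  have i1: "integrable ?\<mu> (\<lambda>u. indicator {..a} u * std_normal_cdf (c * u))" for c
    by (intro integrable_const_bound[where B = 1]) (auto simp: indicator_def b)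
  have i2: "integrable ?\<mu> (indicator {..a} :: real \<Rightarrow> real)"
    by (intro integrable_const_bound[where B = 1]) (auto simp: indicator_def)
  have ia: "(\<integral>u. indicator {..a} u \<partial>?\<mu>) = std_normal_cdf a"
    by (simp add: cdf_def)
  define d h where "d u = indicator {..a} u * std_normal_cdf (\<kappa> * u) - indicator {..a} u * std_normal_cdf (1 * u)"
    and "h u = \<bar>\<kappa> - 1\<bar> * (indicator {..a} u * (1 / 2) - indicator {..a} u * std_normal_cdf (1 * u))" for u
  have id: "integrable ?\<mu> d"
    unfolding d_def by (intro Bochner_Integration.integrable_diff i1)
  have ih: "integrable ?\<mu> h"
    unfolding h_def by (intro integrable_mult_right Bochner_Integration.integrable_diff i1 integrable_mult_left i2)
  have "\<bar>d u\<bar> \<le> h u" for u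
  proof (cases "u \<le> a")
    case True
    then show ?thesis
      using std_normal_cdf_scale_diff[of u \<kappa>] assms by (simp add: d_def h_def)
  qed (simp add: d_def h_def)
  then have "\<bar>integral\<^sup>L ?\<mu> d\<bar> \<le> integral\<^sup>L ?\<mu> h"
    by (intro integral_abs_bound_integral id ih)
  moreover have "integral\<^sup>L ?\<mu> d = (\<integral>u. indicator {..a} u * std_normal_cdf (\<kappa> * u) \<partial>?\<mu>) - (std_normal_cdf a)\<^sup>2 / 2"
    unfolding d_def
    by (subst Bochner_Integration.integral_diff[OF i1 i1]) (simp only: mult_1 integral_std_normal_cdf_atMost)
  moreover have "integral\<^sup>L ?\<mu> h = \<bar>\<kappa> - 1\<bar> * (std_normal_cdf a / 2 - (std_normal_cdf a)\<^sup>2 / 2)"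
    unfolding h_def integral_mult_right_zero
    by (subst Bochner_Integration.integral_diff[OF integrable_mult_left[OF i2] i1])
      (simp only: mult_1 integral_std_normal_cdf_atMost integral_mult_left_zero ia, simp)
  moreover have "\<bar>2 * I - P\<^sup>2\<bar> \<le> K * (P * (1 - P))" if "\<bar>I - P\<^sup>2 / 2\<bar> \<le> K * (P / 2 - P\<^sup>2 / 2)" for I P K :: real
  proof -
    have "2 * I - P\<^sup>2 = 2 * (I - P\<^sup>2 / 2)" by simp
    then have "\<bar>2 * I - P\<^sup>2\<bar> = 2 * \<bar>I - P\<^sup>2 / 2\<bar>" by (simp only: abs_mult abs_numeral)
    also have "\<dots> \<le> 2 * (K * (P / 2 - P\<^sup>2 / 2))" using that by simp
    finally show ?thesis by (simp add: power2_eq_square algebra_simps)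
  qed
  ultimately show ?thesis by (simp only:)
qed

section \<open>Jointly Gaussian pairs\<close>

text \<open>The Fourier transform of the centred bivariate normal law with unit variances and
  correlation \<rho>. Unlike a joint density it makes sense for |\<rho>| = 1, and linear changes of
  variables become substitutions in \<open>s\<close> and \<open>t\<close>.\<close>

definition standard_gaussian_pair :: "'a measure \<Rightarrow> ('a \<Rightarrow> real) \<Rightarrow> ('a \<Rightarrow> real) \<Rightarrow> real \<Rightarrow> bool" where
  "standard_gaussian_pair M U V \<rho> \<longleftrightarrow>
     U \<in> borel_measurable M \<and> V \<in> borel_measurable M \<and>
     (\<forall>s t. (CLINT x|M. iexp (s * U x + t * V x)) =
        complex_of_real (exp (- (s\<^sup>2 + 2 * \<rho> * s * t + t\<^sup>2) / 2)))"

lemma standard_gaussian_pairD: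
  assumes "standard_gaussian_pair M U V \<rho>"
  shows "U \<in> borel_measurable M" "V \<in> borel_measurable M"
    and "(CLINT x|M. iexp (s * U x + t * V x)) =
        complex_of_real (exp (- (s\<^sup>2 + 2 * \<rho> * s * t + t\<^sup>2) / 2))"
  using assms by (auto simp: standard_gaussian_pair_def)

lemma standard_gaussian_pair_swap:
  assumes "standard_gaussian_pair M U V \<rho>"
  shows "standard_gaussian_pair M V U \<rho>"
  unfolding standard_gaussian_pair_def
proof (intro conjI allI)
  fix s t
  have "s * V x + t * U x = t * U x + s * V x" for x by simp
  moreover have "t\<^sup>2 + 2 * \<rho> * t * s + s\<^sup>2 = s\<^sup>2 + 2 * \<rho> * s * t + t\<^sup>2" by simp
  ultimately show "(CLINT x|M. iexp (s * V x + t * U x)) =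
      complex_of_real (exp (- (s\<^sup>2 + 2 * \<rho> * s * t + t\<^sup>2) / 2))"
    using standard_gaussian_pairD(3)[OF assms, of t s] by (simp only:)
qed (use standard_gaussian_pairD(1,2)[OF assms] in auto)

lemma standard_gaussian_pair_uminus:
  assumes "standard_gaussian_pair M U V \<rho>"
  shows "standard_gaussian_pair M (\<lambda>x. - U x) (\<lambda>x. - V x) \<rho>"
  unfolding standard_gaussian_pair_def
proof (intro conjI allI)
  fix s t
  show "(CLINT x|M. iexp (s * - U x + t * - V x)) =
      complex_of_real (exp (- (s\<^sup>2 + 2 * \<rho> * s * t + t\<^sup>2) / 2))"
    using standard_gaussian_pairD(3)[OF assms, of "-s" "-t"] by simp
qed (use standard_gaussian_pairD(1,2)[OF assms] in auto)

lemma (in prob_space) standard_gaussian_pair_marginal: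
  assumes "standard_gaussian_pair M U V \<rho>"
  shows "distr M borel U = std_normal_distribution"
proof (rule Levy_uniqueness)
  note D = standard_gaussian_pairD[OF assms]
  show "real_distribution (distr M borel U)" using D(1) by (rule real_distribution_distr)
  show "real_distribution std_normal_distribution" by (rule real_dist_normal_dist)
  show "char (distr M borel U) = char std_normal_distribution"
  proof
    fix t
    have "char (distr M borel U) t = (CLINT x|M. iexp (t * U x + 0 * V x))"
      unfolding char_def using D(1) by (subst integral_distr) auto
    also have "\<dots> = char std_normal_distribution t"
      by (simp only: D(3) char_std_normal_distribution) simp
    finally show "char (distr M borel U) t = char std_normal_distribution t" .
  qed
qed

lemma (in prob_space) standard_gaussian_pair_prob_le:
  assumes "standard_gaussian_pair M U V \<rho>"
  shows "prob {x\<in>space M. U x \<le> a} = std_normal_cdf a"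
proof -
  note [measurable] = standard_gaussian_pairD(1)[OF assms]
  have "prob {x\<in>space M. U x \<le> a} = measure (distr M borel U) {..a}"
    by (subst measure_distr) (auto intro!: arg_cong[where f = prob])
  then show ?thesis by (simp add: standard_gaussian_pair_marginal[OF assms] cdf_def)
qed

text \<open>On \<open>V \<le> U\<close> the maximum is \<open>U\<close>, and \<open>V \<le> U\<close> says that the part of \<open>V\<close> orthogonal to \<open>U\<close>
  is at most a multiple of \<open>U\<close>.\<close>

lemma (in prob_space) standard_gaussian_pair_max_law:
  assumes P: "standard_gaussian_pair M U V \<rho>" and \<rho>: "\<bar>\<rho>\<bar> < 1"
  defines "\<kappa> \<equiv> (1 - \<rho>) / sqrt (1 - \<rho>\<^sup>2)"
  shows "prob {x\<in>space M. U x \<le> a \<and> V x \<le> U x} =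
      (\<integral>u. indicator {..a} u * std_normal_cdf (\<kappa> * u) \<partial>std_normal_distribution)"
    and "prob {x\<in>space M. V x = U x} = 0"
proof -
  let ?\<mu> = std_normal_distribution
  interpret N: real_distribution ?\<mu> by (rule real_dist_normal_dist)
  note D = standard_gaussian_pairD[OF P]
  note [measurable] = D(1,2)
  define c where "c = sqrt (1 - \<rho>\<^sup>2)"
  have "\<rho>\<^sup>2 < 1" using \<rho> by (simp add: abs_square_less_1)
  then have c: "c > 0" "c\<^sup>2 = 1 - \<rho>\<^sup>2" by (auto simp: c_def)
  \<comment> \<open>The standardised residual of \<open>V\<close> after regression on
    \<open>U\<close>: the pair \<open>U\<close>, \<open>N\<close> has correlation 0, so its
    transform factors and the two are independent.\<close>
  define N where "N x = (V x - \<rho> * U x) / c" for x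
  have [measurable]: "N \<in> borel_measurable M" unfolding N_def by measurable
  have Q: "standard_gaussian_pair M U N 0"
    unfolding standard_gaussian_pair_def
  proof (intro conjI allI)
    fix s t
    have eq: "s * U x + t * N x = (s - t * \<rho> / c) * U x + (t / c) * V x" for x
      using c by (simp add: N_def field_simps)
    define u where "u = t / c"
    have "(s - u * \<rho>)\<^sup>2 + 2 * \<rho> * (s - u * \<rho>) * u + u\<^sup>2 = s\<^sup>2 + u\<^sup>2 * (1 - \<rho>\<^sup>2)"
      by (simp add: power2_eq_square algebra_simps)
    also have "u\<^sup>2 * (1 - \<rho>\<^sup>2) = t\<^sup>2"
      unfolding c(2)[symmetric] power_mult_distrib[symmetric] using c(1) by (simp add: u_def)
    finally have "(s - t * \<rho> / c)\<^sup>2 + 2 * \<rho> * (s - t * \<rho> / c) * (t / c) + (t / c)\<^sup>2 = s\<^sup>2 + t\<^sup>2"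
      by (simp add: u_def)
    then show "(CLINT x|M. iexp (s * U x + t * N x)) =
      complex_of_real (exp (- (s\<^sup>2 + 2 * 0 * s * t + t\<^sup>2) / 2))"
      by (simp only: eq D(3)) simp
  qed measurable
  have "indep_var borel U borel N"
  proof (rule indep_varI_char)
    fix s t
    show "(CLINT x|M. iexp (s * U x + t * N x)) = char (distr M borel U) s * char (distr M borel N) t"
      by (simp only: standard_gaussian_pairD(3)[OF Q] standard_gaussian_pair_marginal[OF Q]
          standard_gaussian_pair_marginal[OF standard_gaussian_pair_swap[OF Q]] char_std_normal_distribution
          of_real_mult[symmetric] exp_add[symmetric])
        (simp add: field_simps)
  qed measurable
  then have law: "distr M (borel \<Otimes>\<^sub>M borel) (\<lambda>x. (U x, N x)) = ?\<mu> \<Otimes>\<^sub>M ?\<mu>"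
    by (simp only: indep_var_distribution_eq standard_gaussian_pair_marginal[OF Q]
          standard_gaussian_pair_marginal[OF standard_gaussian_pair_swap[OF Q]])
  have prob: "prob {x\<in>space M. (U x, N x) \<in> S} = (\<integral>u. measure ?\<mu> (Pair u -` S) \<partial>?\<mu>)"
    if S [measurable]: "S \<in> sets (borel \<Otimes>\<^sub>M borel)" for S
  proof -
    have S': "S \<in> sets (?\<mu> \<Otimes>\<^sub>M ?\<mu>)" using S by simp
    have sec: "(\<lambda>u. emeasure ?\<mu> (Pair u -` S)) \<in> borel_measurable ?\<mu>"
      by (rule N.measurable_emeasure_Pair[OF S'])
    have "emeasure M {x\<in>space M. (U x, N x) \<in> S} = emeasure (?\<mu> \<Otimes>\<^sub>M ?\<mu>) S"
      unfolding law[symmetric]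
      by (subst emeasure_distr) (auto intro!: arg_cong[where f = "emeasure M"])
    also have "\<dots> = (\<integral>\<^sup>+u. emeasure ?\<mu> (Pair u -` S) \<partial>?\<mu>)"
      by (rule N.emeasure_pair_measure_alt[OF S'])
    finally have e: "emeasure M {x\<in>space M. (U x, N x) \<in> S} = (\<integral>\<^sup>+u. ennreal (measure ?\<mu> (Pair u -` S)) \<partial>?\<mu>)"
      by (simp add: N.emeasure_eq_measure)
    have "(\<lambda>u. enn2real (emeasure ?\<mu> (Pair u -` S))) \<in> borel_measurable ?\<mu>"
      using sec by measurable
    then have "(\<integral>u. measure ?\<mu> (Pair u -` S) \<partial>?\<mu>) = enn2real (\<integral>\<^sup>+u. ennreal (measure ?\<mu> (Pair u -` S)) \<partial>?\<mu>)"
      unfolding measure_def[symmetric] by (subst integral_eq_nn_integral) auto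
    then show ?thesis unfolding e[symmetric] by (simp only: measure_def[of M])
  qed
  have mS: "{z. fst z \<le> a \<and> snd z \<le> \<kappa> * fst z} \<in> sets (borel \<Otimes>\<^sub>M borel)"
  proof -
    have "Measurable.pred (borel \<Otimes>\<^sub>M borel) (\<lambda>z :: real \<times> real. fst z \<le> a \<and> snd z \<le> \<kappa> * fst z)"
      by measurable
    then show ?thesis by (simp add: pred_def space_pair_measure)
  qed
  have mD: "{z. snd z = \<kappa> * fst z} \<in> sets (borel \<Otimes>\<^sub>M borel)"
  proof -
    have "Measurable.pred (borel \<Otimes>\<^sub>M borel) (\<lambda>z :: real \<times> real. snd z = \<kappa> * fst z)"
      by measurable
    then show ?thesis by (simp add: pred_def space_pair_measure)
  qed
  have VU: "V x \<le> U x \<longleftrightarrow> N x \<le> \<kappa> * U x" "V x = U x \<longleftrightarrow> N x = \<kappa> * U x" for x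
    using c by (auto simp: N_def \<kappa>_def c_def[symmetric] field_simps)
  have "prob {x\<in>space M. U x \<le> a \<and> V x \<le> U x} = prob {x\<in>space M. (U x, N x) \<in> {z. fst z \<le> a \<and> snd z \<le> \<kappa> * fst z}}"
    by (simp add: VU)
  also have "\<dots> = (\<integral>u. measure ?\<mu> (Pair u -` {z. fst z \<le> a \<and> snd z \<le> \<kappa> * fst z}) \<partial>?\<mu>)"
    by (rule prob[OF mS])
  also have "\<dots> = (\<integral>u. indicator {..a} u * std_normal_cdf (\<kappa> * u) \<partial>?\<mu>)"
  proof (intro Bochner_Integration.integral_cong refl)
    fix u
    have "Pair u -` {z. fst z \<le> a \<and> snd z \<le> \<kappa> * fst z} = (if u \<le> a then {..\<kappa> * u} else {})"
      by auto
    then show "measure ?\<mu> (Pair u -` {z. fst z \<le> a \<and> snd z \<le> \<kappa> * fst z}) = indicator {..a} u * std_normal_cdf (\<kappa> * u)"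
      by (simp add: cdf_def)
  qed
  finally show "prob {x\<in>space M. U x \<le> a \<and> V x \<le> U x} =
      (\<integral>u. indicator {..a} u * std_normal_cdf (\<kappa> * u) \<partial>?\<mu>)" .
  have "prob {x\<in>space M. V x = U x} = prob {x\<in>space M. (U x, N x) \<in> {z. snd z = \<kappa> * fst z}}"
    by (simp add: VU)
  also have "\<dots> = (\<integral>u. measure ?\<mu> (Pair u -` {z. snd z = \<kappa> * fst z}) \<partial>?\<mu>)"
    by (rule prob[OF mD])
  also have "\<dots> = (\<integral>u. 0 \<partial>?\<mu>)"
  proof (intro Bochner_Integration.integral_cong refl)
    fix u
    have "Pair u -` {z. snd z = \<kappa> * fst z} = {\<kappa> * u}" by auto
    then show "measure ?\<mu> (Pair u -` {z. snd z = \<kappa> * fst z}) = 0"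
      by (simp only: std_normal_atomless)
  qed
  finally show "prob {x\<in>space M. V x = U x} = 0" by simp
qed

text \<open>The event is split according to which coordinate is the maximum. Both halves have the
  same probability because the hypothesis is symmetric in the pair, and ties are a null
  event.\<close>

lemma (in prob_space) standard_gaussian_pair_orthant:
  assumes P: "standard_gaussian_pair M U V \<rho>" and \<rho>: "\<bar>\<rho>\<bar> < 1"
  shows "prob {x\<in>space M. U x \<le> a \<and> V x \<le> a} =
    2 * (\<integral>u. indicator {..a} u * std_normal_cdf ((1 - \<rho>) / sqrt (1 - \<rho>\<^sup>2) * u) \<partial>std_normal_distribution)"
proof -
  note [measurable] = standard_gaussian_pairD(1,2)[OF P]
  note 1 = standard_gaussian_pair_max_law[OF P \<rho>]
  note 2 = standard_gaussian_pair_max_law[OF standard_gaussian_pair_swap[OF P] \<rho>]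
  have "prob {x\<in>space M. U x \<le> a \<and> V x \<le> a} =
    prob ({x\<in>space M. U x \<le> a \<and> V x \<le> U x} \<union> ({x\<in>space M. V x \<le> a \<and> U x \<le> V x} - {x\<in>space M. V x = U x}))"
    by (rule arg_cong[where f = prob]) auto
  also have "\<dots> = prob {x\<in>space M. U x \<le> a \<and> V x \<le> U x} +
      prob ({x\<in>space M. V x \<le> a \<and> U x \<le> V x} - {x\<in>space M. V x = U x})"
    by (rule finite_measure_Union) auto
  also have "prob ({x\<in>space M. V x \<le> a \<and> U x \<le> V x} - {x\<in>space M. V x = U x}) = prob {x\<in>space M. V x \<le> a \<and> U x \<le> V x}"
    by (rule measure_Diff_null_set) (auto simp: null_sets_def emeasure_eq_measure 1(2))
  finally show ?thesis using 1(1)[of a] 2(1)[of a] by simp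
qed

text \<open>The quotient is the square root of \<open>(1 - \<rho>) / (1 + \<rho>)\<close>, unbounded
  near \<rho> = -1, so a linear bound holds only away from that end. The root in the denominator is
  bounded below by \<open>1 - \<rho>^2\<close>.\<close>

lemma abs_skew_slope_le:
  fixes \<rho> :: real
  assumes "\<bar>\<rho>\<bar> < 1 / 2"
  shows "\<bar>(1 - \<rho>) / sqrt (1 - \<rho>\<^sup>2) - 1\<bar> \<le> 2 * \<bar>\<rho>\<bar>" and "0 < (1 - \<rho>) / sqrt (1 - \<rho>\<^sup>2)"
proof -
  have r2: "\<rho>\<^sup>2 < 1 / 4"
    using abs_le_square_iff[of "1/2" \<rho>] assms by (auto simp: power2_eq_square)
  then have s: "sqrt (1 - \<rho>\<^sup>2) > 0" by simp
  then show "0 < (1 - \<rho>) / sqrt (1 - \<rho>\<^sup>2)" using assms by simp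
  have s1: "sqrt (1 - \<rho>\<^sup>2) \<le> 1" by simp
  have lb: "1 - \<rho>\<^sup>2 \<le> sqrt (1 - \<rho>\<^sup>2)"
    using r2 by (intro real_le_rsqrt) (simp add: power2_eq_square mult_left_le)
  have "(1 - \<rho>) \<le> (1 + 2 * \<bar>\<rho>\<bar>) * sqrt (1 - \<rho>\<^sup>2)"
  proof (cases "\<rho> \<ge> 0")
    case True
    have "1 - \<rho> \<le> 1 - \<rho>\<^sup>2" using True assms by (simp add: power2_eq_square mult_left_le)
    also have "\<dots> \<le> sqrt (1 - \<rho>\<^sup>2)" by (rule lb)
    also have "\<dots> \<le> (1 + 2 * \<bar>\<rho>\<bar>) * sqrt (1 - \<rho>\<^sup>2)" using s by (simp add: mult_le_cancel_right1)
    finally show ?thesis .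
  next
    case False
    define t where "t = - \<rho>"
    have t: "0 < t" "t < 1 / 2" "\<rho> = - t" using False assms by (auto simp: t_def)
    have "t * t \<le> 1 / 4" using r2 t by (simp add: power2_eq_square)
    have "2 * t * (t * t) \<le> t * (1 / 2)" using \<open>t * t \<le> 1 / 4\<close> t
      by (simp add: mult_left_le)
    moreover have "t * t \<le> t / 2" using t by (simp add: mult_left_mono[of t "1/2" t, simplified])
    \<comment> \<open>The right side minus the left side is
      \<open>t * (1 + t) * (1 - 2 * t)\<close>; this is where |\<rho>| < 1/2 is exactly right for
      the constant 2.\<close>
    ultimately have "1 + t \<le> (1 + 2 * t) * (1 - t * t)" by (simp add: algebra_simps)
    also have "\<dots> \<le> (1 + 2 * t) * sqrt (1 - \<rho>\<^sup>2)"
      using lb t by (intro mult_left_mono) (auto simp: power2_eq_square)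
    finally show ?thesis using t by simp
  qed
  moreover have "(1 - 2 * \<bar>\<rho>\<bar>) * sqrt (1 - \<rho>\<^sup>2) \<le> 1 - \<rho>"
  proof -
    have "(1 - 2 * \<bar>\<rho>\<bar>) * sqrt (1 - \<rho>\<^sup>2) \<le> (1 - 2 * \<bar>\<rho>\<bar>) * 1"
      using assms s1 by (intro mult_left_mono) auto
    then show ?thesis by simp
  qed
  ultimately show "\<bar>(1 - \<rho>) / sqrt (1 - \<rho>\<^sup>2) - 1\<bar> \<le> 2 * \<bar>\<rho>\<bar>"
    using s by (simp add: abs_le_iff divide_simps) (simp add: algebra_simps)
qed

text \<open>For small correlations the orthant formula is compared with its independent case. This
  needs \<open>a\<close> on the negative half-line, where \<Phi> is convex; positive
  \<open>a\<close> is reached by changing both signs. For |\<rho>| >= 1/2 the right side is at least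
  the variance of a single indicator, which bounds any such covariance.\<close>

lemma (in prob_space) standard_gaussian_pair_indicator_cov:
  assumes P: "standard_gaussian_pair M U V \<rho>"
  shows "\<bar>prob {x\<in>space M. U x \<le> a \<and> V x \<le> a} - (std_normal_cdf a)\<^sup>2\<bar>
    \<le> 2 * \<bar>\<rho>\<bar> * (std_normal_cdf a * (1 - std_normal_cdf a))"
proof -
  note [measurable] = standard_gaussian_pairD(1,2)[OF P]
  define p q where "p = std_normal_cdf a" and "q = prob {x\<in>space M. U x \<le> a \<and> V x \<le> a}"
  have p01: "0 < p" "p < 1" unfolding p_def by (rule std_normal_cdf_pos std_normal_cdf_less_1)+
  have pU: "prob {x\<in>space M. U x \<le> a} = p" and pV: "prob {x\<in>space M. V x \<le> a} = p"
    unfolding p_def using standard_gaussian_pair_prob_le[OF P]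
      standard_gaussian_pair_prob_le[OF standard_gaussian_pair_swap[OF P]] by blast+
  have compl: "prob {x\<in>space M. a < U x \<and> a < V x} = 1 - 2 * p + q"
  proof -
    have "prob {x\<in>space M. a < U x \<and> a < V x} = 1 - prob ({x\<in>space M. U x \<le> a} \<union> {x\<in>space M. V x \<le> a})"
      by (subst prob_compl[symmetric]) (auto intro!: arg_cong[where f = prob])
    also have "prob ({x\<in>space M. U x \<le> a} \<union> {x\<in>space M. V x \<le> a}) =
      prob {x\<in>space M. U x \<le> a} + prob {x\<in>space M. V x \<le> a} - prob ({x\<in>space M. U x \<le> a} \<inter> {x\<in>space M. V x \<le> a})"
      by (rule measure_Un3) (auto simp: fmeasurable_eq_sets)
    also have "{x\<in>space M. U x \<le> a} \<inter> {x\<in>space M. V x \<le> a} = {x\<in>space M. U x \<le> a \<and> V x \<le> a}" by auto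
    finally show ?thesis by (simp add: pU pV q_def)
  qed
  show ?thesis
    unfolding p_def[symmetric] q_def[symmetric]
  proof (cases "\<bar>\<rho>\<bar> < 1 / 2")
    case True
    then have \<rho>1: "\<bar>\<rho>\<bar> < 1" by simp
    note \<kappa> = abs_skew_slope_le[OF True]
    have nonpos: "\<bar>prob {x\<in>space M. U' x \<le> b \<and> V' x \<le> b} - (std_normal_cdf b)\<^sup>2\<bar>
      \<le> 2 * \<bar>\<rho>\<bar> * (std_normal_cdf b * (1 - std_normal_cdf b))"
      if P': "standard_gaussian_pair M U' V' \<rho>" and b: "b \<le> 0" for U' V' b
    proof -
      have "\<bar>prob {x\<in>space M. U' x \<le> b \<and> V' x \<le> b} - (std_normal_cdf b)\<^sup>2\<bar>
        \<le> \<bar>(1 - \<rho>) / sqrt (1 - \<rho>\<^sup>2) - 1\<bar> * (std_normal_cdf b * (1 - std_normal_cdf b))"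
        unfolding standard_gaussian_pair_orthant[OF P' \<rho>1]
        by (rule std_normal_skew_integral_bound[OF b \<kappa>(2)])
      also have "\<dots> \<le> 2 * \<bar>\<rho>\<bar> * (std_normal_cdf b * (1 - std_normal_cdf b))"
        using std_normal_cdf_pos[of b] std_normal_cdf_less_1[of b]
        by (intro mult_right_mono \<kappa>) simp
      finally show ?thesis .
    qed
    show "\<bar>q - p\<^sup>2\<bar> \<le> 2 * \<bar>\<rho>\<bar> * (p * (1 - p))"
    proof (cases "a \<le> 0")
      case True
      then show ?thesis using nonpos[OF P] by (simp only: p_def q_def)
    next
      case False
      \<comment> \<open>After the change of signs the events are non-strict at \<open>- a\<close>,
        whereas \<open>compl\<close> has strict ones; the difference is null.\<close>
      have 0: "prob {x\<in>space M. U x = a} = 0"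
      proof -
        have "prob {x\<in>space M. U x = a} = measure (distr M borel U) {a}"
          by (subst measure_distr) (auto intro!: arg_cong[where f = prob])
        then show ?thesis by (simp only: standard_gaussian_pair_marginal[OF P] std_normal_atomless)
      qed
      have 00: "prob {x\<in>space M. V x = a} = 0"
      proof -
        have "prob {x\<in>space M. V x = a} = measure (distr M borel V) {a}"
          by (subst measure_distr) (auto intro!: arg_cong[where f = prob])
        then show ?thesis
          by (simp only: standard_gaussian_pair_marginal[OF standard_gaussian_pair_swap[OF P]] std_normal_atomless)
      qed
      have "prob {x\<in>space M. - U x \<le> - a \<and> - V x \<le> - a} = prob {x\<in>space M. a < U x \<and> a < V x}"
      proof (rule finite_measure_eq_AE)
        have "AE x in M. U x \<noteq> a" "AE x in M. V x \<noteq> a"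
          using 0 00 by (auto simp: AE_iff_measurable[OF _ refl] emeasure_eq_measure)
        then show "AE x in M. x \<in> {x\<in>space M. - U x \<le> - a \<and> - V x \<le> - a} \<longleftrightarrow> x \<in> {x\<in>space M. a < U x \<and> a < V x}"
          by eventually_elim auto
      qed measurable
      moreover have "(1 - 2 * p + q) - (1 - p)\<^sup>2 = q - p\<^sup>2"
        by (simp add: power2_eq_square algebra_simps)
      moreover have "(1 - p) * (1 - (1 - p)) = p * (1 - p)" by simp
      moreover have "\<bar>prob {x\<in>space M. - U x \<le> - a \<and> - V x \<le> - a} - (1 - p)\<^sup>2\<bar>
          \<le> 2 * \<bar>\<rho>\<bar> * ((1 - p) * (1 - (1 - p)))"
        using nonpos[OF standard_gaussian_pair_uminus[OF P], of "- a"] False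
        unfolding std_normal_cdf_minus p_def[symmetric] by simp
      ultimately show ?thesis by (simp only: compl)
    qed
  next
    case False
    have "q \<le> p" unfolding q_def pU[symmetric] by (rule finite_measure_mono) auto
    moreover have "0 \<le> q" unfolding q_def by simp
    moreover have "0 \<le> 1 - 2 * p + q" unfolding compl[symmetric] by simp
    ultimately have h: "q \<le> p" "0 \<le> q" "0 \<le> 1 - 2 * p + q" by auto
    \<comment> \<open>The lower bound uses whichever trivial bound is better: \<open>q\<close>
      nonnegative for \<open>p\<close> up to 1/2, and \<open>q\<close> at least
      \<open>2 * p - 1\<close> beyond, where the deficit is at most
      \<open>(1 - p)^2\<close>.\<close>
    have "\<bar>q - p\<^sup>2\<bar> \<le> p * (1 - p)"
    proof -
      have "q - p\<^sup>2 \<le> p * (1 - p)" using h by (simp add: power2_eq_square algebra_simps)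
      moreover have "- (q - p\<^sup>2) \<le> p * (1 - p)"
      proof (cases "p \<le> 1 / 2")
        case True
        have "p * (2 * p) \<le> p * 1" using True p01 by (intro mult_left_mono) auto
        then show ?thesis using h by (simp add: power2_eq_square algebra_simps)
      next
        case F: False
        have "(1 - p) * (2 * (1 - p)) \<le> (1 - p) * 1" using F p01 by (intro mult_left_mono) auto
        then show ?thesis using h by (simp add: power2_eq_square algebra_simps)
      qed
      ultimately show ?thesis by (simp add: abs_le_iff)
    qed
    also have "\<dots> \<le> 2 * \<bar>\<rho>\<bar> * (p * (1 - p))"
      using mult_right_mono[of 1 "2 * \<bar>\<rho>\<bar>" "p * (1 - p)"] False p01 by simp
    finally show "\<bar>q - p\<^sup>2\<bar> \<le> 2 * \<bar>\<rho>\<bar> * (p * (1 - p))" .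
  qed
qed

section \<open>Gaussian processes and quantile transforms\<close>

text \<open>The nondegenerate law is rescaled to the standard normal one; in the degenerate case the
  variable is almost surely 0. That case does occur, for instance for \<open>W i x - W j x\<close>
  when \<open>i = j\<close> or the correlation is 1.\<close>

lemma (in prob_space) gaussian_rv_char:
  assumes G: "gaussian_rv M U" and m: "expectation U = 0"
  shows "U \<in> borel_measurable M" and "integrable M (\<lambda>x. (U x)\<^sup>2)"
    and "(CLINT x|M. iexp (U x)) = complex_of_real (exp (- expectation (\<lambda>x. (U x)\<^sup>2) / 2))"
proof -
  have "U \<in> borel_measurable M \<and> integrable M (\<lambda>x. (U x)\<^sup>2) \<and>
    (CLINT x|M. iexp (U x)) = complex_of_real (exp (- expectation (\<lambda>x. (U x)\<^sup>2) / 2))"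
    using G unfolding gaussian_rv_def
  proof (elim disjE exE conjE)
    fix m' s assume s: "s > 0" and D': "distributed M lborel U (normal_density m' s)"
    have "m' = 0" using normal_distributed_expectation[OF s D'] m by simp
    with D' have D: "distributed M lborel U (normal_density 0 s)" by simp
    have [measurable]: "U \<in> borel_measurable M"
      using distributed_measurable[OF D] by simp
    have "integrable lborel (\<lambda>x. normal_density 0 s x * x\<^sup>2)"
      using integrable_normal_moment[OF s, of 0 2] by simp
    then have i: "integrable M (\<lambda>x. (U x)\<^sup>2)"
      using distributed_integrable[OF D, of "\<lambda>x. x\<^sup>2"] by simp
    have v: "expectation (\<lambda>x. (U x)\<^sup>2) = s\<^sup>2"
      using normal_distributed_variance[OF s D] m by simp
    have Z: "distributed M lborel (\<lambda>x. (U x - 0) / s) std_normal_density"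
      using normal_standard_normal_convert[OF s, of U 0] D by blast
    have "(CLINT x|M. iexp (U x)) = (CLINT x|M. iexp (s * ((U x - 0) / s)))"
      using s by simp
    also have "\<dots> = (CLINT z|distr M lborel (\<lambda>x. (U x - 0) / s). iexp (s * z))"
      by (subst integral_distr) auto
    also have "\<dots> = char std_normal_distribution s"
      unfolding char_def by (simp only: distributed_distr_eq_density[OF Z])
    finally show ?thesis using i v by (simp add: char_std_normal_distribution)
  next
    fix m' assume [measurable]: "U \<in> borel_measurable M" and ae: "AE x in M. U x = m'"
    have "expectation U = expectation (\<lambda>_. m')"
      by (rule integral_cong_AE) (use ae in auto)
    then have "m' = 0" using m by (simp add: prob_space)
    then have ae0: "AE x in M. U x = 0" using ae by simp
    have "integrable M (\<lambda>x. (U x)\<^sup>2) \<longleftrightarrow> integrable M (\<lambda>x. 0 :: real)"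
      by (rule integrable_cong_AE) (use ae0 in auto)
    moreover have "expectation (\<lambda>x. (U x)\<^sup>2) = expectation (\<lambda>x. 0)"
      by (rule integral_cong_AE) (use ae0 in auto)
    moreover have "(CLINT x|M. iexp (U x)) = (CLINT x|M. 1)"
      by (rule integral_cong_AE) (use ae0 in auto)
    ultimately show ?thesis by (simp add: prob_space)
  qed
  then show "U \<in> borel_measurable M" and "integrable M (\<lambda>x. (U x)\<^sup>2)"
    and "(CLINT x|M. iexp (U x)) = complex_of_real (exp (- expectation (\<lambda>x. (U x)\<^sup>2) / 2))"
    by blast+
qed

locale standard_gaussian_process = prob_space M for M :: "'a measure" +
  fixes W :: "nat \<Rightarrow> 'a \<Rightarrow> real"
  assumes gauss: "gaussian_process M W"
    and mean_zero: "\<And>k. k \<ge> 1 \<Longrightarrow> expectation (W k) = 0"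
    and unit_variance: "\<And>k. k \<ge> 1 \<Longrightarrow> variance (W k) = 1"
begin

lemma gaussian_rv_component: "k \<ge> 1 \<Longrightarrow> gaussian_rv M (W k)"
  using gauss[unfolded gaussian_process_def, rule_format, of "{k}" "\<lambda>_. 1"] by simp

lemma measurable_component: "k \<ge> 1 \<Longrightarrow> W k \<in> borel_measurable M"
  using gaussian_rv_char(1)[OF gaussian_rv_component mean_zero] by blast

lemma integrable_square: "k \<ge> 1 \<Longrightarrow> integrable M (\<lambda>x. (W k x)\<^sup>2)"
  using gaussian_rv_char(2)[OF gaussian_rv_component mean_zero] by blast

lemma expectation_square: "k \<ge> 1 \<Longrightarrow> expectation (\<lambda>x. (W k x)\<^sup>2) = 1"
  using unit_variance mean_zero by simp

lemma integrable_component: "k \<ge> 1 \<Longrightarrow> integrable M (W k)"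
  using square_integrable_imp_integrable[OF measurable_component integrable_square] by blast

lemma integrable_product:
  assumes "i \<ge> 1" "j \<ge> 1"
  shows "integrable M (\<lambda>x. W i x * W j x)"
proof (rule Bochner_Integration.integrable_bound)
  show "integrable M (\<lambda>x. (W i x)\<^sup>2 + (W j x)\<^sup>2)"
    using assms by (intro Bochner_Integration.integrable_add integrable_square)
  have "\<bar>a * b\<bar> \<le> a\<^sup>2 + b\<^sup>2" for a b :: real
  proof -
    have "2 * (\<bar>a\<bar> * \<bar>b\<bar>) \<le> a\<^sup>2 + b\<^sup>2"
      using sum_squares_bound[of "\<bar>a\<bar>" "\<bar>b\<bar>"] by simp
    moreover have "0 \<le> \<bar>a\<bar> * \<bar>b\<bar>" by simp
    ultimately show ?thesis unfolding abs_mult by linarith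
  qed
  then show "AE x in M. norm (W i x * W j x) \<le> norm ((W i x)\<^sup>2 + (W j x)\<^sup>2)" by simp
qed (use assms measurable_component in auto)

lemma covariance_eq:
  "i \<ge> 1 \<Longrightarrow> j \<ge> 1 \<Longrightarrow> covariance M (W i) (W j) = expectation (\<lambda>x. W i x * W j x)"
  by (simp add: covariance_def mean_zero)

lemma covariance_self: "i \<ge> 1 \<Longrightarrow> covariance M (W i) (W i) = 1"
  using expectation_square by (simp add: covariance_eq power2_eq_square)

lemma abs_covariance_le_1:
  assumes "i \<ge> 1" "j \<ge> 1"
  shows "\<bar>covariance M (W i) (W j)\<bar> \<le> 1"
proof -
  have "\<bar>expectation (\<lambda>x. W i x * W j x)\<bar> \<le> expectation (\<lambda>x. ((W i x)\<^sup>2 + (W j x)\<^sup>2) / 2)"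
  proof (rule order.trans[OF integral_abs_bound integral_mono])
    fix x
    show "\<bar>W i x * W j x\<bar> \<le> ((W i x)\<^sup>2 + (W j x)\<^sup>2) / 2"
      using sum_squares_bound[of "\<bar>W i x\<bar>" "\<bar>W j x\<bar>"] by (simp add: abs_mult)
  qed (use assms integrable_product integrable_square in auto)
  also have "\<dots> = 1"
    using assms by (simp add: integrable_square expectation_square)
  finally show ?thesis using assms by (simp add: covariance_eq)
qed

lemma gaussian_pair:
  assumes i: "i \<ge> 1" and j: "j \<ge> 1"
  shows "standard_gaussian_pair M (W i) (W j) (covariance M (W i) (W j))"
  unfolding standard_gaussian_pair_def
proof (intro conjI allI)
  show "W i \<in> borel_measurable M" "W j \<in> borel_measurable M"
    using assms measurable_component by auto
  fix s t
  let ?U = "\<lambda>x. s * W i x + t * W j x"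
  have G: "gaussian_rv M ?U"
  \<comment> \<open>For equal indices the set \<open>{i, j}\<close> is a singleton, so its single
    coefficient has to be \<open>s + t\<close>.\<close>
  proof (cases "i = j")
    case True
    have "(\<lambda>x. \<Sum>k\<in>{i}. (s + t) * W k x) = ?U" using True by (simp add: distrib_right)
    then show ?thesis
      using gauss[unfolded gaussian_process_def, rule_format, of "{i}" "\<lambda>_. s + t"] i by simp
  next
    case False
    have "(\<lambda>x. \<Sum>k\<in>{i, j}. (if k = i then s else t) * W k x) = ?U" using False by simp
    then show ?thesis
      using gauss[unfolded gaussian_process_def, rule_format, of "{i, j}" "\<lambda>k. if k = i then s else t"] i j
      by simp
  qed
  have m: "expectation ?U = 0"
    using assms integrable_component mean_zero by simp
  have "(?U x)\<^sup>2 = s\<^sup>2 * (W i x)\<^sup>2 + 2 * s * t * (W i x * W j x) + t\<^sup>2 * (W j x)\<^sup>2" for x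
    by (simp add: power2_eq_square algebra_simps)
  then have "expectation (\<lambda>x. (?U x)\<^sup>2) =
      expectation (\<lambda>x. s\<^sup>2 * (W i x)\<^sup>2 + 2 * s * t * (W i x * W j x) + t\<^sup>2 * (W j x)\<^sup>2)"
    by simp
  also have "\<dots> = s\<^sup>2 + 2 * s * t * covariance M (W i) (W j) + t\<^sup>2"
    using assms integrable_product[OF i j] by (simp add: integrable_square expectation_square covariance_eq)
  finally have "expectation (\<lambda>x. (?U x)\<^sup>2) = s\<^sup>2 + 2 * covariance M (W i) (W j) * s * t + t\<^sup>2"
    by simp
  then show "(CLINT x|M. iexp (s * W i x + t * W j x)) =
        complex_of_real (exp (- (s\<^sup>2 + 2 * covariance M (W i) (W j) * s * t + t\<^sup>2) / 2))"
    using gaussian_rv_char(3)[OF G m] by simp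
qed

text \<open>The diagonal gives the lower bound and |covariance| at most 1 the upper one. The first
  absorbs the fluctuation of the proxy into that of \<open>Z\<close>, the second turns the L1 rate
  into the rate for \<open>r = 2\<close>.\<close>

lemma covariance_sum_bounds:
  shows "real n \<le> (\<Sum>i=1..n. \<Sum>j=1..n. \<bar>covariance M (W i) (W j)\<bar>)"
    and "(\<Sum>i=1..n. \<Sum>j=1..n. \<bar>covariance M (W i) (W j)\<bar>) \<le> (real n)\<^sup>2"
proof -
  have "(\<Sum>i=1..n. 1) \<le> (\<Sum>i=1..n. \<Sum>j=1..n. \<bar>covariance M (W i) (W j)\<bar>)"
  proof (rule sum_mono)
    fix i assume i: "i \<in> {1..n}"
    have "1 = \<bar>covariance M (W i) (W i)\<bar>" using i covariance_self by simp
    also have "\<dots> \<le> (\<Sum>j=1..n. \<bar>covariance M (W i) (W j)\<bar>)"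
      by (rule member_le_sum[where f = "\<lambda>j. \<bar>covariance M (W i) (W j)\<bar>"]) (use i in auto)
    finally show "1 \<le> (\<Sum>j=1..n. \<bar>covariance M (W i) (W j)\<bar>)" .
  qed
  then show "real n \<le> (\<Sum>i=1..n. \<Sum>j=1..n. \<bar>covariance M (W i) (W j)\<bar>)" by simp
  have "(\<Sum>i=1..n. \<Sum>j=1..n. \<bar>covariance M (W i) (W j)\<bar>) \<le> (\<Sum>i=1..n. \<Sum>j=1..n. 1)"
    by (intro sum_mono abs_covariance_le_1) auto
  then show "(\<Sum>i=1..n. \<Sum>j=1..n. \<bar>covariance M (W i) (W j)\<bar>) \<le> (real n)\<^sup>2"
    by (simp add: power2_eq_square)
qed

end

lemma quantile_le_iff:
  assumes "real_distribution \<nu>" "0 < u" "u < 1"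
  shows "quantile (cdf \<nu>) u \<le> x \<longleftrightarrow> u \<le> cdf \<nu> x"
proof -
  interpret cdf_distribution \<nu> using assms(1) by (simp add: cdf_distribution_def)
  show ?thesis using pseudoinverse[OF assms(2,3), of x] by (simp add: quantile_def)
qed

lemma quantile_std_normal_le_iff:
  assumes "real_distribution \<nu>"
  shows "quantile (cdf \<nu>) (std_normal_cdf w) \<le> x \<longleftrightarrow> std_normal_cdf w \<le> cdf \<nu> x"
  using assms std_normal_cdf_pos std_normal_cdf_less_1 by (intro quantile_le_iff)

lemma (in standard_gaussian_process) measurable_quantile_component:
  assumes "real_distribution \<nu>" "k \<ge> 1"
  shows "(\<lambda>x. quantile (cdf \<nu>) (std_normal_cdf (W k x))) \<in> borel_measurable M"
proof (rule borel_measurableI_le)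
  fix y
  have [measurable]: "std_normal_cdf \<in> borel_measurable borel"
    by (intro borel_measurable_continuous_onI continuous_std_normal_cdf)
  have [measurable]: "W k \<in> borel_measurable M" using assms by (simp add: measurable_component)
  show "{x \<in> space M. quantile (cdf \<nu>) (std_normal_cdf (W k x)) \<le> y} \<in> sets M"
    unfolding quantile_std_normal_le_iff[OF assms(1)] by measurable
qed

text \<open>If \<Phi>(a) is the value of the distribution function at \<open>y\<close>, the event
  \<open>Z k x \<le> y\<close> is \<open>W k x \<le> a\<close>, jumps and flat pieces
  notwithstanding. No such \<open>a\<close> exists for the values 0 and 1, where the event is
  impossible or certain.\<close>

lemma (in standard_gaussian_process) quantile_component_cov:
  assumes \<nu>: "real_distribution \<nu>" and i: "i \<ge> 1" and j: "j \<ge> 1"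
  defines "Z \<equiv> \<lambda>k x. quantile (cdf \<nu>) (std_normal_cdf (W k x))"
  shows "prob {x\<in>space M. Z i x \<le> y} = cdf \<nu> y"
    and "\<bar>prob {x\<in>space M. Z i x \<le> y \<and> Z j x \<le> y} - (cdf \<nu> y)\<^sup>2\<bar> \<le>
      2 * \<bar>covariance M (W i) (W j)\<bar> * (cdf \<nu> y * (1 - cdf \<nu> y))"
proof -
  interpret N: real_distribution \<nu> by fact
  have F: "0 \<le> cdf \<nu> y" "cdf \<nu> y \<le> 1"
    using N.cdf_bounded_prob finite_borel_measure.cdf_nonneg[OF N.finite_borel_measure_M] by auto
  consider "cdf \<nu> y = 0" | "cdf \<nu> y = 1" | "0 < cdf \<nu> y" "cdf \<nu> y < 1"
    using F by linarith
  then have "prob {x\<in>space M. Z i x \<le> y} = cdf \<nu> y \<and>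
    \<bar>prob {x\<in>space M. Z i x \<le> y \<and> Z j x \<le> y} - (cdf \<nu> y)\<^sup>2\<bar> \<le>
      2 * \<bar>covariance M (W i) (W j)\<bar> * (cdf \<nu> y * (1 - cdf \<nu> y))"
  proof cases
    case 1
    then have "\<not> Z k x \<le> y" for k x
      unfolding Z_def quantile_std_normal_le_iff[OF \<nu>] using std_normal_cdf_pos[of "W k x"] by simp
    with 1 show ?thesis by simp
  next
    case 2
    then have "Z k x \<le> y" for k x
      unfolding Z_def quantile_std_normal_le_iff[OF \<nu>] using std_normal_cdf_less_1[of "W k x"] by simp
    with 2 show ?thesis by (simp add: prob_space)
  next
    case 3
    then obtain a where a: "std_normal_cdf a = cdf \<nu> y" by (rule std_normal_cdf_surj)
    have "Z k x \<le> y \<longleftrightarrow> W k x \<le> a" for k x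
      unfolding Z_def quantile_std_normal_le_iff[OF \<nu>] a[symmetric]
      by (rule strict_mono_less_eq[OF std_normal_cdf_strict_mono])
    then show ?thesis
      using standard_gaussian_pair_prob_le[OF gaussian_pair[OF i j], of a]
        standard_gaussian_pair_indicator_cov[OF gaussian_pair[OF i j], of a]
      by (simp only: a)
  qed
  then show "prob {x\<in>space M. Z i x \<le> y} = cdf \<nu> y"
    and "\<bar>prob {x\<in>space M. Z i x \<le> y \<and> Z j x \<le> y} - (cdf \<nu> y)\<^sup>2\<bar> \<le>
      2 * \<bar>covariance M (W i) (W j)\<bar> * (cdf \<nu> y * (1 - cdf \<nu> y))"
    by blast+
qed

section \<open>Counting functions, rearrangements and the estimator\<close>

text \<open>The empirical distribution function without its factor 1/n. It depends only on the
  multiset of the values, which is why sorting never has to be followed through the probability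
  estimates.\<close>

definition count_le :: "nat \<Rightarrow> (nat \<Rightarrow> real) \<Rightarrow> real \<Rightarrow> real" where
  "count_le n a x = (\<Sum>k=1..n. indicat_real {..x} (a k))"

lemma measurable_count_le [measurable]: "count_le n a \<in> borel_measurable borel"
proof -
  have "(\<lambda>x. \<Sum>k=1..n. indicat_real {a k..} x) \<in> borel_measurable borel" by measurable
  moreover have "count_le n a = (\<lambda>x. \<Sum>k=1..n. indicat_real {a k..} x)"
    by (auto simp: count_le_def indicator_def fun_eq_iff)
  ultimately show ?thesis by simp
qed

lemma sum_increasing_rearrangement:
  "(\<Sum>k=1..n. f (increasing_rearrangement n a k)) = (\<Sum>k=1..n. f (a k) :: real)"
proof -
  let ?xs = "map a [1..<Suc n]"
  define ys where "ys = sort ?xs"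
  have len: "length ys = n" by (simp add: ys_def)
  have "(\<Sum>k=1..n. f (increasing_rearrangement n a k)) = (\<Sum>i<n. f (ys ! i))"
    unfolding increasing_rearrangement_def ys_def
    by (rule sum.reindex_bij_witness[where i = Suc and j = "\<lambda>k. k - 1"]) auto
  also have "\<dots> = sum_list (map f ys)"
    by (simp add: sum_list_sum_nth len atLeast0LessThan)
  also have "\<dots> = sum_list (map f ?xs)"
    by (simp only: ys_def sum_mset_sum_list[symmetric] mset_map mset_sort)
  also have "\<dots> = (\<Sum>k=1..n. f (a k))"
    by (simp add: sum_list_distinct_conv_sum_set comp_def atLeastLessThanSuc_atLeastAtMost del: upt_Suc)
  finally show ?thesis .
qed

lemma mono_on_increasing_rearrangement:
  "mono_on {1..n} (increasing_rearrangement n a)"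
  unfolding increasing_rearrangement_def
  by (rule mono_onI, rule sorted_nth_mono) auto

lemma count_le_increasing_rearrangement:
  "count_le n (increasing_rearrangement n a) = count_le n a"
  unfolding count_le_def by (rule ext, rule sum_increasing_rearrangement)

text \<open>For non-decreasing vectors the indices with value at most \<open>x\<close> form initial
  segments, and two initial segments are nested. Hence all the differences have the same
  sign.\<close>

lemma sum_abs_indicator_diff_mono:
  assumes a: "mono_on {1..n} a" and b: "mono_on {1..n} b"
  shows "(\<Sum>k=1..n. \<bar>indicat_real {..x} (a k) - indicat_real {..x} (b k)\<bar>) = \<bar>count_le n a x - count_le n b x\<bar>"
proof -
  have "(\<forall>k\<in>{1..n}. indicat_real {..x} (a k) \<le> indicat_real {..x} (b k)) \<or>
        (\<forall>k\<in>{1..n}. indicat_real {..x} (b k) \<le> indicat_real {..x} (a k))"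
  proof (rule ccontr)
    assume "\<not> ?thesis"
    then obtain k l where k: "k \<in> {1..n}" "a k \<le> x" "x < b k" and l: "l \<in> {1..n}" "b l \<le> x" "x < a l"
      by (auto simp: indicator_def not_le split: if_splits)
    have "b k \<le> b l \<or> a l \<le> a k"
      using mono_onD[OF b k(1) l(1)] mono_onD[OF a l(1) k(1)] by linarith
    with k l show False by linarith
  qed
  then show ?thesis
  proof
    assume h: "\<forall>k\<in>{1..n}. indicat_real {..x} (a k) \<le> indicat_real {..x} (b k)"
    then have "count_le n a x \<le> count_le n b x"
      unfolding count_le_def by (intro sum_mono) auto
    moreover have "(\<Sum>k=1..n. \<bar>indicat_real {..x} (a k) - indicat_real {..x} (b k)\<bar>) =
       (\<Sum>k=1..n. indicat_real {..x} (b k) - indicat_real {..x} (a k))"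
      using h by (intro sum.cong) auto
    ultimately show ?thesis by (simp add: count_le_def sum_subtractf)
  next
    assume h: "\<forall>k\<in>{1..n}. indicat_real {..x} (b k) \<le> indicat_real {..x} (a k)"
    then have "count_le n b x \<le> count_le n a x"
      unfolding count_le_def by (intro sum_mono) auto
    moreover have "(\<Sum>k=1..n. \<bar>indicat_real {..x} (a k) - indicat_real {..x} (b k)\<bar>) =
       (\<Sum>k=1..n. indicat_real {..x} (a k) - indicat_real {..x} (b k))"
      using h by (intro sum.cong) auto
    ultimately show ?thesis by (simp add: count_le_def sum_subtractf)
  qed
qed

lemma abs_diff_eq_nn_integral:
  fixes a b :: real
  shows "ennreal \<bar>a - b\<bar> = (\<integral>\<^sup>+x. ennreal \<bar>indicat_real {..x} a - indicat_real {..x} b\<bar> \<partial>lborel)"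
proof -
  have "(\<integral>\<^sup>+x. ennreal \<bar>indicat_real {..x} a - indicat_real {..x} b\<bar> \<partial>lborel) =
      (\<integral>\<^sup>+x. indicator {min a b..<max a b} x \<partial>lborel)"
    by (intro nn_integral_cong) (auto simp: indicator_def)
  also have "\<dots> = ennreal \<bar>a - b\<bar>" by (simp add: max_def min_def)
  finally show ?thesis by simp
qed

lemma sum_abs_diff_eq_nn_integral:
  "ennreal (\<Sum>k=1..n. \<bar>a k - b k\<bar>) =
    (\<integral>\<^sup>+x. ennreal (\<Sum>k=1..n. \<bar>indicat_real {..x} (a k) - indicat_real {..x} (b k)\<bar>) \<partial>lborel)"
proof -
  have m: "(\<lambda>x. ennreal \<bar>indicat_real {..x} (a k) - indicat_real {..x} (b k)\<bar>) \<in> borel_measurable lborel" for k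
  proof -
    have "(\<lambda>x. ennreal \<bar>indicat_real {a k..} x - indicat_real {b k..} x\<bar>) \<in> borel_measurable lborel" by measurable
    then show ?thesis by (simp add: indicator_def)
  qed
  have "ennreal (\<Sum>k=1..n. \<bar>a k - b k\<bar>) = (\<Sum>k=1..n. ennreal \<bar>a k - b k\<bar>)" by simp
  also have "\<dots> = (\<Sum>k=1..n. \<integral>\<^sup>+x. ennreal \<bar>indicat_real {..x} (a k) - indicat_real {..x} (b k)\<bar> \<partial>lborel)"
    by (intro sum.cong refl abs_diff_eq_nn_integral)
  also have "\<dots> = (\<integral>\<^sup>+x. (\<Sum>k=1..n. ennreal \<bar>indicat_real {..x} (a k) - indicat_real {..x} (b k)\<bar>) \<partial>lborel)"
    by (rule nn_integral_sum[symmetric]) (rule m)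
  finally show ?thesis by simp
qed

text \<open>Each distance is the length of the set of levels \<open>x\<close> that separate the two
  numbers; for sorted vectors the separations at one level add up without cancellation. This is the
  formula for optimal transport on the line.\<close>

lemma sum_abs_diff_mono_on:
  assumes "mono_on {1..n} a" "mono_on {1..n} b"
  shows "ennreal (\<Sum>k=1..n. \<bar>a k - b k\<bar>) = (\<integral>\<^sup>+x. ennreal \<bar>count_le n a x - count_le n b x\<bar> \<partial>lborel)"
  by (subst sum_abs_diff_eq_nn_integral) (simp only: sum_abs_indicator_diff_mono[OF assms])

text \<open>Without sorting there may be cancellation, so only an inequality remains. Combined with
  \<open>sum_abs_diff_mono_on\<close> it says that sorting is an L1 contraction.\<close>

lemma nn_integral_count_le_diff_le:
  "(\<integral>\<^sup>+x. ennreal \<bar>count_le n a x - count_le n b x\<bar> \<partial>lborel) \<le> ennreal (\<Sum>k=1..n. \<bar>a k - b k\<bar>)"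
  by (subst sum_abs_diff_eq_nn_integral, intro nn_integral_mono ennreal_leI)
    (simp add: count_le_def sum_subtractf[symmetric] sum_abs)

text \<open>The sorted vector of \<open>\<sigma> * Z\<close> is the intermediate point: by
  contraction it is within the L1 norm of \<open>Y\<close> from the sorted \<open>X\<close>, and its
  distance to \<open>\<sigma> * \<psi>\<close> is a transport distance. The estimate is pathwise, so
  the joint law of \<open>Y\<close> and \<open>Z\<close> does not enter.\<close>

lemma sum_abs_rearrangement_proxy_le:
  assumes \<psi>: "mono_on {1..n} \<psi>" and \<sigma>: "\<sigma> > 0" and X: "\<And>k. k \<in> {1..n} \<Longrightarrow> X k = Y k + \<sigma> * Z k"
  shows "ennreal (\<Sum>k=1..n. \<bar>increasing_rearrangement n X k - \<sigma> * \<psi> k\<bar>) \<le>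
    ennreal (\<Sum>k=1..n. \<bar>Y k\<bar>) +
    ennreal \<sigma> * (\<integral>\<^sup>+x. ennreal \<bar>count_le n Z x - count_le n \<psi> x\<bar> \<partial>lborel)"
proof -
  let ?X = "increasing_rearrangement n X" and ?Z = "increasing_rearrangement n Z"
  have mono: "mono_on {1..n} (\<lambda>k. \<sigma> * ?Z k)"
    using mono_on_increasing_rearrangement[of n Z] \<sigma> by (auto simp: mono_on_def)
  have cnt: "count_le n (\<lambda>k. \<sigma> * ?Z k) = count_le n (\<lambda>k. \<sigma> * Z k)"
    unfolding count_le_def
    by (rule ext, rule sum_increasing_rearrangement[of "\<lambda>z. indicat_real {..x} (\<sigma> * z)" for x])
  have "ennreal (\<Sum>k=1..n. \<bar>?X k - \<sigma> * ?Z k\<bar>) \<le> ennreal (\<Sum>k=1..n. \<bar>X k - \<sigma> * Z k\<bar>)"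
    unfolding sum_abs_diff_mono_on[OF mono_on_increasing_rearrangement mono] cnt count_le_increasing_rearrangement
    by (rule nn_integral_count_le_diff_le)
  also have "(\<Sum>k=1..n. \<bar>X k - \<sigma> * Z k\<bar>) = (\<Sum>k=1..n. \<bar>Y k\<bar>)"
    using X by (intro sum.cong) auto
  finally have 1: "ennreal (\<Sum>k=1..n. \<bar>?X k - \<sigma> * ?Z k\<bar>) \<le> ennreal (\<Sum>k=1..n. \<bar>Y k\<bar>)" .
  have 2: "ennreal (\<Sum>k=1..n. \<bar>?Z k - \<psi> k\<bar>) = (\<integral>\<^sup>+x. ennreal \<bar>count_le n Z x - count_le n \<psi> x\<bar> \<partial>lborel)"
    by (simp only: sum_abs_diff_mono_on[OF mono_on_increasing_rearrangement \<psi>] count_le_increasing_rearrangement)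
  have "(\<Sum>k=1..n. \<bar>?X k - \<sigma> * \<psi> k\<bar>) \<le> (\<Sum>k=1..n. \<bar>?X k - \<sigma> * ?Z k\<bar> + \<sigma> * \<bar>?Z k - \<psi> k\<bar>)"
  proof (rule sum_mono)
    fix k
    have "\<bar>?X k - \<sigma> * \<psi> k\<bar> \<le> \<bar>?X k - \<sigma> * ?Z k\<bar> + \<bar>\<sigma> * (?Z k - \<psi> k)\<bar>"
      by (simp add: algebra_simps)
    then show "\<bar>?X k - \<sigma> * \<psi> k\<bar> \<le> \<bar>?X k - \<sigma> * ?Z k\<bar> + \<sigma> * \<bar>?Z k - \<psi> k\<bar>"
      using \<sigma> by (simp add: abs_mult)
  qed
  also have "\<dots> = (\<Sum>k=1..n. \<bar>?X k - \<sigma> * ?Z k\<bar>) + \<sigma> * (\<Sum>k=1..n. \<bar>?Z k - \<psi> k\<bar>)"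
    by (simp add: sum.distrib sum_distrib_left)
  finally have "ennreal (\<Sum>k=1..n. \<bar>?X k - \<sigma> * \<psi> k\<bar>) \<le>
      ennreal ((\<Sum>k=1..n. \<bar>?X k - \<sigma> * ?Z k\<bar>) + \<sigma> * (\<Sum>k=1..n. \<bar>?Z k - \<psi> k\<bar>))"
    by (rule ennreal_leI)
  also have "\<dots> = ennreal (\<Sum>k=1..n. \<bar>?X k - \<sigma> * ?Z k\<bar>) + ennreal \<sigma> * ennreal (\<Sum>k=1..n. \<bar>?Z k - \<psi> k\<bar>)"
    using \<sigma> by (subst ennreal_plus) (auto intro!: sum_nonneg mult_nonneg_nonneg simp: ennreal_mult)
  also have "\<dots> \<le> ennreal (\<Sum>k=1..n. \<bar>Y k\<bar>) + ennreal \<sigma> * (\<integral>\<^sup>+x. ennreal \<bar>count_le n Z x - count_le n \<psi> x\<bar> \<partial>lborel)"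
    unfolding 2 by (intro add_mono 1 order_refl)
  finally show ?thesis .
qed

text \<open>For \<open>r = 1\<close> the loss at the minimiser is compared with the loss at \<open>\<sigma>\<close>; for \<open>r = 2\<close> the
  normal equation of least squares is used, so that only first powers of the residuals appear.\<close>

lemma arg_min_weighted_power_dist:
  fixes w x \<psi> :: "nat \<Rightarrow> real"
  assumes r: "r \<in> {1, 2}"
    and w: "\<And>k. k \<in> I \<Longrightarrow> 0 \<le> w k \<and> w k \<le> 1"
    and B: "\<And>k. k \<in> I \<Longrightarrow> w k * \<bar>\<psi> k\<bar> ^ r \<le> B" and B0: "0 \<le> B"
    and S: "is_arg_min (\<lambda>s. \<Sum>k\<in>I. w k * \<bar>x k - s * \<psi> k\<bar> ^ r) (\<lambda>_. True) S"
  shows "\<bar>S - \<sigma>\<bar> * (\<Sum>k\<in>I. w k * \<bar>\<psi> k\<bar> ^ r) \<le> (2 + B) * (\<Sum>k\<in>I. \<bar>x k - \<sigma> * \<psi> k\<bar>)"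
proof -
  let ?L = "\<lambda>s. \<Sum>k\<in>I. w k * \<bar>x k - s * \<psi> k\<bar> ^ r"
  have min: "?L S \<le> ?L s" for s
    using S by (auto simp: is_arg_min_linorder)
  define R where "R = (\<Sum>k\<in>I. \<bar>x k - \<sigma> * \<psi> k\<bar>)"
  have R0: "0 \<le> R" unfolding R_def by (intro sum_nonneg) auto
  show ?thesis
  proof (cases "r = 1")
    case True
    have "?L \<sigma> \<le> R"
      unfolding True R_def using w by (intro sum_mono) (simp add: mult_left_le_one_le)
    have "\<bar>S - \<sigma>\<bar> * (\<Sum>k\<in>I. w k * \<bar>\<psi> k\<bar> ^ r) = (\<Sum>k\<in>I. w k * \<bar>(S - \<sigma>) * \<psi> k\<bar>)"
      unfolding True by (simp add: sum_distrib_left abs_mult mult_ac)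
    also have "\<dots> \<le> (\<Sum>k\<in>I. w k * \<bar>x k - S * \<psi> k\<bar> ^ r + w k * \<bar>x k - \<sigma> * \<psi> k\<bar> ^ r)"
    proof (rule sum_mono)
      fix k assume k: "k \<in> I"
      have "\<bar>(S - \<sigma>) * \<psi> k\<bar> \<le> \<bar>x k - S * \<psi> k\<bar> + \<bar>x k - \<sigma> * \<psi> k\<bar>"
        by (simp add: algebra_simps)
      then have "w k * \<bar>(S - \<sigma>) * \<psi> k\<bar> \<le> w k * (\<bar>x k - S * \<psi> k\<bar> + \<bar>x k - \<sigma> * \<psi> k\<bar>)"
        using w[OF k] by (intro mult_left_mono) auto
      then show "w k * \<bar>(S - \<sigma>) * \<psi> k\<bar> \<le> w k * \<bar>x k - S * \<psi> k\<bar> ^ r + w k * \<bar>x k - \<sigma> * \<psi> k\<bar> ^ r"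
        unfolding True by (simp add: distrib_left)
    qed
    also have "\<dots> = ?L S + ?L \<sigma>" by (rule sum.distrib)
    also have "\<dots> \<le> 2 * R" using min[of \<sigma>] \<open>?L \<sigma> \<le> R\<close> by simp
    also have "\<dots> \<le> (2 + B) * R" using B0 R0 by (simp add: distrib_right)
    finally show ?thesis unfolding R_def .
  next
    case False
    with r have r2: "r = 2" by simp
    define A where "A = (\<Sum>k\<in>I. w k * (\<psi> k)\<^sup>2)"
    define C where "C = (\<Sum>k\<in>I. w k * \<psi> k * (x k - S * \<psi> k))"
    have A0: "0 \<le> A" unfolding A_def using w by (intro sum_nonneg) auto
    have expand: "?L (S + h) = ?L S - 2 * h * C + h\<^sup>2 * A" for h
    proof -
      have "?L (S + h) = (\<Sum>k\<in>I. w k * (x k - S * \<psi> k)\<^sup>2 - 2 * h * (w k * \<psi> k * (x k - S * \<psi> k)) + h\<^sup>2 * (w k * (\<psi> k)\<^sup>2))"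
        unfolding r2 by (intro sum.cong) (auto simp: power2_eq_square algebra_simps)
      also have "\<dots> = ?L S - 2 * h * C + h\<^sup>2 * A"
        unfolding r2 A_def C_def by (simp add: sum.distrib sum_subtractf sum_distrib_left)
      finally show ?thesis .
    qed
    have "C = 0"
    proof (rule ccontr)
      assume "C \<noteq> 0"
      \<comment> \<open>A descent step contradicting minimality. The denominator
        \<open>1 + A\<close> instead of \<open>A\<close> also covers \<open>A = 0\<close>, where the
        loss would be linear in \<open>h\<close>.\<close>
      define h where "h = C / (1 + A)"
      have hC: "C = h * (1 + A)" and h0: "h \<noteq> 0" using A0 \<open>C \<noteq> 0\<close> by (auto simp: h_def)
      have "0 \<le> - 2 * h * C + h\<^sup>2 * A" using min[of "S + h"] expand[of h] by simp
      also have "\<dots> = - (h\<^sup>2 * (2 + A))"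
        by (subst hC) (simp add: power2_eq_square algebra_simps)
      also have "\<dots> < 0" using A0 h0 by simp
      finally show False by simp
    qed
    have "(\<Sum>k\<in>I. w k * \<psi> k * (x k - \<sigma> * \<psi> k)) = C + (S - \<sigma>) * A"
      unfolding A_def C_def by (simp add: sum_distrib_left sum.distrib[symmetric] power2_eq_square algebra_simps)
    with \<open>C = 0\<close> have eq: "(S - \<sigma>) * A = (\<Sum>k\<in>I. w k * \<psi> k * (x k - \<sigma> * \<psi> k))" by simp
    have "\<bar>S - \<sigma>\<bar> * (\<Sum>k\<in>I. w k * \<bar>\<psi> k\<bar> ^ r) = \<bar>(S - \<sigma>) * A\<bar>"
      using A0 unfolding r2 A_def by (simp add: abs_mult)
    also have "\<dots> \<le> (\<Sum>k\<in>I. \<bar>w k * \<psi> k * (x k - \<sigma> * \<psi> k)\<bar>)" unfolding eq by (rule sum_abs)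
    also have "\<dots> \<le> (\<Sum>k\<in>I. (2 + B) * \<bar>x k - \<sigma> * \<psi> k\<bar>)"
    proof (rule sum_mono)
      fix k assume k: "k \<in> I"
      have "\<bar>\<psi> k\<bar> \<le> 1 + \<bar>\<psi> k\<bar>\<^sup>2"
        using sum_squares_bound[of 1 "\<bar>\<psi> k\<bar>"] by simp
      \<comment> \<open>From \<open>w k\<close> at most 1 and the bound on the weighted square comes
        the factor \<open>1 + B\<close>; it is rounded up to \<open>2 + B\<close>, which also covers
        the factor 2 in the case \<open>r = 1\<close>.\<close>
      then have "w k * \<bar>\<psi> k\<bar> \<le> w k * (1 + \<bar>\<psi> k\<bar>\<^sup>2)" using w[OF k] by (intro mult_left_mono) auto
      also have "\<dots> \<le> 2 + B" using w[OF k] B[OF k] unfolding r2 by (simp add: distrib_left)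
      finally have "w k * \<bar>\<psi> k\<bar> * \<bar>x k - \<sigma> * \<psi> k\<bar> \<le> (2 + B) * \<bar>x k - \<sigma> * \<psi> k\<bar>"
        by (rule mult_right_mono) simp
      then show "\<bar>w k * \<psi> k * (x k - \<sigma> * \<psi> k)\<bar> \<le> (2 + B) * \<bar>x k - \<sigma> * \<psi> k\<bar>"
        using w[OF k] by (simp add: abs_mult)
    qed
    finally show ?thesis by (simp add: sum_distrib_left)
  qed
qed

section \<open>Moment bounds and tightness\<close>

text \<open>Bernoulli's inequality for real exponents: the graph lies above its tangent at 1. It
  reduces to two uses of the tangent of the exponential, one of them in the form of
  \<open>ln (1 / t)\<close> at most \<open>1 / t - 1\<close>.\<close>

lemma powr_ge_tangent_at_1:
  fixes t p :: real
  assumes "0 \<le> t" "1 \<le> p"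
  shows "1 + p * (t - 1) \<le> t powr p"
proof (cases "t = 0")
  case False
  with assms have t: "t > 0" by simp
  have l: "t - 1 \<le> t * ln t"
    using ln_le_minus_one[of "1 / t"] t by (simp add: ln_div field_simps)
  have "1 + p * (t - 1) = t + (p - 1) * (t - 1)" by (simp add: algebra_simps)
  also have "\<dots> \<le> t + (p - 1) * (t * ln t)" using l assms by (intro add_left_mono mult_left_mono) auto
  also have "\<dots> = t * (1 + (p - 1) * ln t)" by (simp add: algebra_simps)
  also have "\<dots> \<le> t * exp ((p - 1) * ln t)" using t by (intro mult_left_mono exp_ge_add_one_self) auto
  also have "\<dots> = t powr 1 * t powr (p - 1)" using t by (simp add: powr_def)
  also have "\<dots> = t powr p" by (simp only: powr_add[symmetric]) simp
  finally show ?thesis .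
qed (use assms in simp)

lemma mean_abs_le_p_norm:
  assumes p: "1 \<le> p" and n: "1 \<le> n"
  shows "(\<Sum>k=1..n. \<bar>y k\<bar>) / real n \<le> real n powr (- 1 / p) * p_norm p n y"
proof -
  define S where "S = (\<Sum>k=1..n. \<bar>y k\<bar> powr p)"
  have S0: "0 \<le> S" unfolding S_def by (intro sum_nonneg) auto
  show ?thesis
  proof (cases "S = 0")
    case True
    then have "\<forall>k\<in>{1..n}. \<bar>y k\<bar> powr p = 0"
      unfolding S_def by (subst (asm) sum_nonneg_eq_0_iff) auto
    then have "(\<Sum>k=1..n. \<bar>y k\<bar>) = 0" by (intro sum.neutral) auto
    then show ?thesis by (simp add: p_norm_def)
  next
    case False
    with S0 have S: "S > 0" by simp
    \<comment> \<open>The power mean of order \<open>p\<close>. Dividing by it makes the mean of the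
      \<open>p\<close>-th powers equal to 1, so the averaged tangent inequality reads: the mean of
      the quotients is at most 1.\<close>
    define A where "A = (S / real n) powr (1 / p)"
    have A: "A > 0" using S n by (simp add: A_def)
    have Ap: "A powr p = S / real n" using p S n by (simp add: A_def powr_powr)
    have "(\<Sum>k=1..n. 1 + p * (\<bar>y k\<bar> / A - 1)) \<le> (\<Sum>k=1..n. (\<bar>y k\<bar> / A) powr p)"
      using A p by (intro sum_mono powr_ge_tangent_at_1) auto
    also have "\<dots> = S / A powr p"
      unfolding S_def using A by (simp add: powr_divide sum_divide_distrib)
    also have "\<dots> = real n" using Ap S n by simp
    finally have "real n + p * ((\<Sum>k=1..n. \<bar>y k\<bar>) / A - real n) \<le> real n"
      by (simp add: sum.distrib sum_subtractf sum_distrib_left[symmetric] sum_divide_distrib[symmetric])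
    then have "p * ((\<Sum>k=1..n. \<bar>y k\<bar>) / A - real n) \<le> 0" by simp
    then have "(\<Sum>k=1..n. \<bar>y k\<bar>) / A \<le> real n" using p by (simp add: mult_le_0_iff)
    then have "(\<Sum>k=1..n. \<bar>y k\<bar>) / real n \<le> A" using A n by (simp add: field_simps)
    also have "A = real n powr (- 1 / p) * S powr (1 / p)"
      using n S by (simp add: A_def powr_divide powr_minus divide_simps)
    also have "S powr (1 / p) = p_norm p n y" by (simp only: p_norm_def S_def)
    finally show ?thesis .
  qed
qed

context prob_space
begin

text \<open>A second moment computation with abstract covariance bounds: \<open>c\<close> will be
  twice the absolute Gaussian covariances for \<open>Z\<close> and the Kronecker delta for an i.i.d.
  sample, while \<open>v\<close> is the variance of one indicator.\<close>

lemma expectation_abs_count_le: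
  assumes Z: "\<And>k. k \<in> {1..n} \<Longrightarrow> Z k \<in> borel_measurable M"
    and marg: "\<And>k. k \<in> {1..n} \<Longrightarrow> prob {x\<in>space M. Z k x \<le> y} = u"
    and cov: "\<And>i j. i \<in> {1..n} \<Longrightarrow> j \<in> {1..n} \<Longrightarrow>
      \<bar>prob {x\<in>space M. Z i x \<le> y \<and> Z j x \<le> y} - u\<^sup>2\<bar> \<le> c i j * v"
  shows "expectation (\<lambda>x. \<bar>count_le n (\<lambda>k. Z k x) y - real n * u\<bar>) \<le> sqrt ((\<Sum>i=1..n. \<Sum>j=1..n. c i j) * v)"
proof -
  define h where "h k x = indicat_real {..y} (Z k x)" for k x
  have hm [measurable]: "h k \<in> borel_measurable M" if "k \<in> {1..n}" for k
    unfolding h_def using Z[OF that] by measurable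
  have ih: "integrable M (h k)" if "k \<in> {1..n}" for k
    using hm[OF that] by (intro integrable_const_bound[where B = 1]) (auto simp: h_def indicator_def)
  have ihh: "integrable M (\<lambda>x. h i x * h j x)" if "i \<in> {1..n}" "j \<in> {1..n}" for i j
  proof (rule integrable_const_bound[where B = 1])
    show "(\<lambda>x. h i x * h j x) \<in> borel_measurable M"
      using that by (intro borel_measurable_times hm)
  qed (simp add: h_def indicator_def)
  have Eh: "expectation (h k) = u" if "k \<in> {1..n}" for k
  proof -
    have "expectation (h k) = expectation (indicat_real {x\<in>space M. Z k x \<le> y})"
      by (intro Bochner_Integration.integral_cong) (auto simp: h_def indicator_def)
    also have "\<dots> = prob {x\<in>space M. Z k x \<le> y}"
      by (simp add: Int_absorb2 subset_eq)
    finally show ?thesis using marg[OF that] by simp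
  qed
  have Ehh: "expectation (\<lambda>x. h i x * h j x) = prob {x\<in>space M. Z i x \<le> y \<and> Z j x \<le> y}"
    if "i \<in> {1..n}" "j \<in> {1..n}" for i j
  proof -
    have "expectation (\<lambda>x. h i x * h j x) = expectation (indicat_real {x\<in>space M. Z i x \<le> y \<and> Z j x \<le> y})"
      by (intro Bochner_Integration.integral_cong) (auto simp: h_def indicator_def)
    then show ?thesis by (simp add: Int_absorb2 subset_eq)
  qed
  define f where "f x = (\<Sum>k=1..n. h k x - u)" for x
  have f_eq: "f x = count_le n (\<lambda>k. Z k x) y - real n * u" for x
    by (simp add: f_def h_def count_le_def sum_subtractf)
  have sq: "(f x)\<^sup>2 = (\<Sum>i=1..n. \<Sum>j=1..n. h i x * h j x - u * h i x - u * h j x + u\<^sup>2)" for x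
    unfolding f_def power2_eq_square sum_product by (intro sum.cong refl) (simp add: algebra_simps)
  have int2: "integrable M (\<lambda>x. h i x * h j x - u * h i x - u * h j x + u\<^sup>2)"
    if "i \<in> {1..n}" "j \<in> {1..n}" for i j
    using ih ihh that by auto
  have if2: "integrable M (\<lambda>x. (f x)\<^sup>2)"
    unfolding sq by (intro Bochner_Integration.integrable_sum int2)
  have if1: "integrable M f"
    unfolding f_def using ih by (intro Bochner_Integration.integrable_sum) auto
  have "expectation (\<lambda>x. (f x)\<^sup>2) = (\<Sum>i=1..n. \<Sum>j=1..n. expectation (\<lambda>x. h i x * h j x - u * h i x - u * h j x + u\<^sup>2))"
    unfolding sq by (subst Bochner_Integration.integral_sum, intro Bochner_Integration.integrable_sum int2, assumption+,
      intro sum.cong refl Bochner_Integration.integral_sum int2, assumption+)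
  also have "\<dots> \<le> (\<Sum>i=1..n. \<Sum>j=1..n. c i j * v)"
  proof (intro sum_mono)
    fix i j assume ij: "i \<in> {1..n}" "j \<in> {1..n}"
    have "expectation (\<lambda>x. h i x * h j x - u * h i x - u * h j x + u\<^sup>2) =
        prob {x\<in>space M. Z i x \<le> y \<and> Z j x \<le> y} - u\<^sup>2"
      using ij ih ihh by (simp add: Eh Ehh prob_space power2_eq_square)
    then show "expectation (\<lambda>x. h i x * h j x - u * h i x - u * h j x + u\<^sup>2) \<le> c i j * v"
      using cov[OF ij] by linarith
  qed
  also have "\<dots> = (\<Sum>i=1..n. \<Sum>j=1..n. c i j) * v" by (simp add: sum_distrib_right)
  finally have E2: "expectation (\<lambda>x. (f x)\<^sup>2) \<le> (\<Sum>i=1..n. \<Sum>j=1..n. c i j) * v" .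
  \<comment> \<open>Nonnegativity of the variance of \<open>\<bar>f\<bar>\<close> serves as the
    Cauchy-Schwarz inequality.\<close>
  have "0 \<le> variance (\<lambda>x. \<bar>f x\<bar>)" by (rule variance_positive)
  also have "\<dots> = expectation (\<lambda>x. \<bar>f x\<bar>\<^sup>2) - (expectation (\<lambda>x. \<bar>f x\<bar>))\<^sup>2"
    using if1 if2 by (intro variance_eq) auto
  finally have "(expectation (\<lambda>x. \<bar>f x\<bar>))\<^sup>2 \<le> expectation (\<lambda>x. (f x)\<^sup>2)" by simp
  with E2 have "(expectation (\<lambda>x. \<bar>f x\<bar>))\<^sup>2 \<le> (\<Sum>i=1..n. \<Sum>j=1..n. c i j) * v" by linarith
  then have "expectation (\<lambda>x. \<bar>f x\<bar>) \<le> sqrt ((\<Sum>i=1..n. \<Sum>j=1..n. c i j) * v)"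
    by (rule real_le_rsqrt)
  then show ?thesis by (simp only: f_eq)
qed

lemma measurable_count_le_pair:
  assumes Z: "\<And>k. k \<in> {1..n} \<Longrightarrow> Z k \<in> borel_measurable M"
  shows "(\<lambda>(x, y). count_le n (\<lambda>k. Z k x) y) \<in> borel_measurable (M \<Otimes>\<^sub>M borel)"
proof -
  have "(\<lambda>z. indicat_real {..snd z} (Z k (fst z))) \<in> borel_measurable (M \<Otimes>\<^sub>M borel)"
    if "k \<in> {1..n}" for k
  proof -
    have [measurable]: "Z k \<in> borel_measurable M" using Z[OF that] .
    have "(\<lambda>z. if Z k (fst z) \<le> snd z then 1 else 0 :: real) \<in> borel_measurable (M \<Otimes>\<^sub>M borel)"
      by measurable
    then show ?thesis by (simp add: indicator_def of_bool_def)
  qed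
  then have "(\<lambda>z. \<Sum>k=1..n. indicat_real {..snd z} (Z k (fst z))) \<in> borel_measurable (M \<Otimes>\<^sub>M borel)"
    by (intro borel_measurable_sum)
  then show ?thesis by (simp add: count_le_def split_beta')
qed

lemma measurable_count_le_at:
  assumes Z: "\<And>k. k \<in> {1..n} \<Longrightarrow> Z k \<in> borel_measurable M"
  shows "(\<lambda>x. count_le n (\<lambda>k. Z k x) y) \<in> borel_measurable M"
  using measurable_compose[OF measurable_Pair[OF measurable_ident_sets[OF refl] measurable_const[of y borel M]]
      measurable_count_le_pair[OF Z]]
  by simp

lemma integrable_count_le:
  assumes Z: "\<And>k. k \<in> {1..n} \<Longrightarrow> Z k \<in> borel_measurable M"
  shows "integrable M (\<lambda>x. \<bar>count_le n (\<lambda>k. Z k x) y - c\<bar>)"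
proof (rule integrable_const_bound[where B = "real n + \<bar>c\<bar>"])
  show "(\<lambda>x. \<bar>count_le n (\<lambda>k. Z k x) y - c\<bar>) \<in> borel_measurable M"
    using measurable_count_le_at[OF Z] by measurable
  have "\<bar>count_le n a y\<bar> \<le> real n" for a
  proof -
    have "\<bar>count_le n a y\<bar> \<le> (\<Sum>k=1..n. \<bar>indicat_real {..y} (a k)\<bar>)" unfolding count_le_def by (rule sum_abs)
    also have "\<dots> \<le> (\<Sum>k=1..n. 1)" by (intro sum_mono) (simp add: indicator_def)
    finally show ?thesis by simp
  qed
  note b = this
  show "AE x in M. norm \<bar>count_le n (\<lambda>k. Z k x) y - c\<bar> \<le> real n + \<bar>c\<bar>"
  proof (intro AE_I2)
    fix x
    show "norm \<bar>count_le n (\<lambda>k. Z k x) y - c\<bar> \<le> real n + \<bar>c\<bar>"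
      using b[of "\<lambda>k. Z k x"] by simp
  qed
qed

lemma measurable_count_le_pair_lborel:
  assumes Z: "\<And>k. k \<in> {1..n} \<Longrightarrow> Z k \<in> borel_measurable M"
  shows "(\<lambda>z. count_le n (\<lambda>k. Z k (fst z)) (snd z)) \<in> borel_measurable (M \<Otimes>\<^sub>M lborel)"
proof -
  have "(\<lambda>(x, y). count_le n (\<lambda>k. Z k x) y) \<in> borel_measurable (M \<Otimes>\<^sub>M lborel)"
    using measurable_count_le_pair[OF Z] by (simp cong: measurable_cong_sets sets_pair_measure_cong)
  then show ?thesis by (simp add: split_beta')
qed

text \<open>Tonelli's theorem turns the bound at each level \<open>y\<close> into one for the
  expected transport distance. The sample enters only through \<open>s\<close>, and \<open>g\<close>
  is the function whose integral is assumed finite.\<close>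

lemma nn_integral_count_le_dist:
  assumes Z: "\<And>k. k \<in> {1..n} \<Longrightarrow> Z k \<in> borel_measurable M"
    and [measurable]: "F \<in> borel_measurable borel" "g \<in> borel_measurable borel"
    and s: "0 \<le> s"
    and bd: "\<And>y. expectation (\<lambda>x. \<bar>count_le n (\<lambda>k. Z k x) y - real n * F y\<bar>) \<le> s * g y"
  shows "(\<integral>\<^sup>+x. \<integral>\<^sup>+y. ennreal \<bar>count_le n (\<lambda>k. Z k x) y - real n * F y\<bar> \<partial>lborel \<partial>M) \<le>
    ennreal s * (\<integral>\<^sup>+y. ennreal (g y) \<partial>lborel)"
proof -
  interpret P: pair_sigma_finite M lborel by standard
  note [measurable] = measurable_count_le_pair_lborel[OF Z]
  have "(\<integral>\<^sup>+x. \<integral>\<^sup>+y. ennreal \<bar>count_le n (\<lambda>k. Z k x) y - real n * F y\<bar> \<partial>lborel \<partial>M) =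
    (\<integral>\<^sup>+y. \<integral>\<^sup>+x. ennreal \<bar>count_le n (\<lambda>k. Z k x) y - real n * F y\<bar> \<partial>M \<partial>lborel)"
  proof (rule P.Fubini'[symmetric])
    have "(\<lambda>z. ennreal \<bar>count_le n (\<lambda>k. Z k (fst z)) (snd z) - real n * F (snd z)\<bar>) \<in> borel_measurable (M \<Otimes>\<^sub>M lborel)"
      by measurable
    then show "(\<lambda>(x, y). ennreal \<bar>count_le n (\<lambda>k. Z k x) y - real n * F y\<bar>) \<in> borel_measurable (M \<Otimes>\<^sub>M lborel)"
      by (simp add: split_beta')
  qed
  also have "\<dots> \<le> (\<integral>\<^sup>+y. ennreal s * ennreal (g y) \<partial>lborel)"
  proof (rule nn_integral_mono)
    fix y
    have "(\<integral>\<^sup>+x. ennreal \<bar>count_le n (\<lambda>k. Z k x) y - real n * F y\<bar> \<partial>M) =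
      ennreal (expectation (\<lambda>x. \<bar>count_le n (\<lambda>k. Z k x) y - real n * F y\<bar>))"
      by (rule nn_integral_eq_integral[OF integrable_count_le[OF Z]]) auto
    also have "\<dots> \<le> ennreal (s * g y)" by (rule ennreal_leI[OF bd])
    finally show "(\<integral>\<^sup>+x. ennreal \<bar>count_le n (\<lambda>k. Z k x) y - real n * F y\<bar> \<partial>M) \<le> ennreal s * ennreal (g y)"
      using s by (simp add: ennreal_mult')
  qed
  also have "\<dots> = ennreal s * (\<integral>\<^sup>+y. ennreal (g y) \<partial>lborel)"
    by (rule nn_integral_cmult) measurable
  finally show ?thesis .
qed

end

text \<open>The quantile grid satisfies the fluctuation bound of an i.i.d. sample up to a factor 2,
  so the two proxies can be treated alike. The count is the floor of \<open>(n + 1) * u\<close>,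
  capped at \<open>n\<close>.\<close>

lemma abs_grid_count_le:
  fixes u :: real
  assumes u: "0 \<le> u" "u \<le> 1" and n: "1 \<le> n"
  shows "\<bar>(\<Sum>k=1..n. if real k / (real n + 1) \<le> u then 1 else 0) - real n * u\<bar> \<le> 2 * sqrt (real n) * sqrt (u * (1 - u))"
proof -
  define t where "t = (real n + 1) * u"
  define N where "N = min n (nat \<lfloor>t\<rfloor>)"
  have t0: "0 \<le> t" using u by (simp add: t_def)
  have iff: "real k / (real n + 1) \<le> u \<longleftrightarrow> k \<le> nat \<lfloor>t\<rfloor>" for k
  proof -
    have "real k / (real n + 1) \<le> u \<longleftrightarrow> real k \<le> t" by (simp add: t_def divide_simps mult.commute)
    also have "\<dots> \<longleftrightarrow> k \<le> nat \<lfloor>t\<rfloor>" using t0 by (simp add: le_nat_iff le_floor_iff)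
    finally show ?thesis .
  qed
  have "(\<Sum>k=1..n. if real k / (real n + 1) \<le> u then 1 else 0 :: real) = (\<Sum>k\<in>{1..N}. 1)"
    unfolding iff by (rule sum.mono_neutral_cong_right) (auto simp: N_def)
  also have "\<dots> = real N" by simp
  finally have eq: "(\<Sum>k=1..n. if real k / (real n + 1) \<le> u then 1 else 0 :: real) = real N" .
  have fl: "real (nat \<lfloor>t\<rfloor>) \<le> t" "t < real (nat \<lfloor>t\<rfloor>) + 1" using t0 by (auto intro: of_nat_floor)
  have n1: "1 \<le> real n" using n by simp
  \<comment> \<open>One of \<open>u\<close>, \<open>1 - u\<close> is at least 1/2 and the other at
    least \<open>1 / (n + 1)\<close>; hence a rounding error of size 1 is admissible away from the
    ends.\<close>
  have q: "1 \<le> 4 * real n * (u * (1 - u))" if a: "1 / (real n + 1) \<le> u" and b: "1 / (real n + 1) \<le> 1 - u"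
  proof -
    have "1 / (2 * (real n + 1)) \<le> u * (1 - u)"
    proof (cases "u \<le> 1 / 2")
      case True
      have "1 / (real n + 1) * (1 / 2) \<le> u * (1 - u)" using a True u by (intro mult_mono) auto
      then show ?thesis by (simp add: mult.commute)
    next
      case False
      have "(1 / 2) * (1 / (real n + 1)) \<le> u * (1 - u)" using b False u by (intro mult_mono) auto
      then show ?thesis by simp
    qed
    then have "4 * real n * (1 / (2 * (real n + 1))) \<le> 4 * real n * (u * (1 - u))"
      by (intro mult_left_mono) auto
    moreover have "1 \<le> 4 * real n * (1 / (2 * (real n + 1)))" using n1 by (simp add: field_simps)
    ultimately show ?thesis by linarith
  qed
  have half: "1 / (real n + 1) \<le> 1 / 2" using n1 by (simp add: field_simps)
  have "(real N - real n * u)\<^sup>2 \<le> 4 * real n * (u * (1 - u))"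
  proof -
    \<comment> \<open>Near the ends \<open>u * (1 - u)\<close> may be arbitrarily small, so an error
      of size 1 is too much. But there the error is exactly \<open>n * u\<close> or
      \<open>n * (1 - u)\<close>, at most 1, and its square is small with it.\<close>
    consider (low) "t < 1" | (high) "real n \<le> t" | (mid) "1 \<le> t" "t < real n" by linarith
    then show ?thesis
    proof cases
      case low
      then have "N = 0" using t0 by (simp add: N_def floor_eq_iff nat_eq_iff)
      have u1: "u < 1 / (real n + 1)" using low by (simp add: t_def field_simps)
      have nu: "real n * u \<le> 1" using low u by (simp add: t_def algebra_simps)
      have "1 \<le> 4 * (1 - u)" using order.strict_trans2[OF u1 half] by simp
      from order.trans[OF nu this] have "real n * u \<le> 4 * (1 - u)" .
      then have "(real n * u) * (real n * u) \<le> (real n * u) * (4 * (1 - u))"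
        using u by (intro mult_left_mono) auto
      then show ?thesis using \<open>N = 0\<close> by (simp add: power2_eq_square algebra_simps)
    next
      case high
      then have "N = n" using fl by (simp add: N_def) linarith
      have u1: "1 - u \<le> 1 / (real n + 1)" using high by (simp add: t_def field_simps)
      then have nu: "real n * (1 - u) \<le> 1" using u by (simp add: field_simps)
      have "1 \<le> 4 * u" using order.trans[OF u1 half] by simp
      from order.trans[OF nu this] have "real n * (1 - u) \<le> 4 * u" .
      then have "(real n * (1 - u)) * (real n * (1 - u)) \<le> (real n * (1 - u)) * (4 * u)"
        using u by (intro mult_left_mono) auto
      then show ?thesis using \<open>N = n\<close> by (simp add: power2_eq_square algebra_simps)
    next
      case mid
      then have "real N = real (nat \<lfloor>t\<rfloor>)" using fl by (simp add: N_def) linarith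
      then have "t - 1 < real N" "real N \<le> t" using fl by auto
      then have "\<bar>real N - real n * u\<bar> \<le> 1" using u by (simp add: t_def abs_le_iff algebra_simps)
      then have "(real N - real n * u)\<^sup>2 \<le> 1" by (simp add: abs_square_le_1)
      also have "1 \<le> 4 * real n * (u * (1 - u))"
        using mid by (intro q) (auto simp: t_def field_simps)
      finally show ?thesis .
    qed
  qed
  then have "\<bar>real N - real n * u\<bar> \<le> sqrt (4 * real n * (u * (1 - u)))"
    by (intro real_le_rsqrt) simp
  also have "\<dots> = 2 * sqrt (real n) * sqrt (u * (1 - u))" by (simp add: real_sqrt_mult)
  finally show ?thesis by (simp only: eq)
qed

text \<open>The set where \<open>g\<close> is positive is covered by countably many intervals with
  rational endpoints and rational lower bounds. If none were charged, \<open>g\<close> would vanish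
  almost surely. The intervals are half-open so that their mass is a difference of values of the
  distribution function.\<close>

lemma ex_interval_lower_bound:
  fixes g :: "real \<Rightarrow> real"
  assumes \<nu>: "real_distribution \<nu>" and g: "continuous_on UNIV g" "\<And>x. 0 \<le> g x"
    and pos: "(\<integral>x. g x \<partial>\<nu>) > 0"
  obtains a b \<delta> where "a < b" "\<delta> > 0" "\<And>x. a < x \<Longrightarrow> x \<le> b \<Longrightarrow> \<delta> \<le> g x" "cdf \<nu> a < cdf \<nu> b"
proof -
  interpret real_distribution \<nu> by fact
  define J where "J = {(a, b, \<delta>). a \<in> \<rat> \<and> b \<in> \<rat> \<and> \<delta> \<in> \<rat> \<and> a < b \<and> 0 < \<delta> \<and> (\<forall>x. a < x \<longrightarrow> x \<le> b \<longrightarrow> \<delta> \<le> g x)}"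
  have cJ: "countable J"
    by (rule countable_subset[of _ "\<rat> \<times> \<rat> \<times> \<rat>"]) (auto simp: J_def countable_rat)
  have cover: "\<exists>z\<in>J. x \<in> {fst z<..fst (snd z)}" if gx: "g x > 0" for x
  proof -
    have "isCont g x" using g(1) by (simp add: continuous_on_eq_continuous_at)
    then have "eventually (\<lambda>y. g x / 2 < g y) (nhds x)"
      using gx by (intro order_tendstoD(1)[where y = "g x"]) (auto simp: continuous_at tendsto_at_iff_tendsto_nhds)
    then obtain e where e: "e > 0" "\<And>y. dist y x < e \<Longrightarrow> g x / 2 < g y"
      unfolding eventually_nhds_metric by auto
    obtain a where a: "a \<in> \<rat>" "x - e < a" "a < x" using Rats_dense_in_real[of "x - e" x] e by auto
    obtain b where b: "b \<in> \<rat>" "x < b" "b < x + e" using Rats_dense_in_real[of x "x + e"] e by auto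
    obtain d where d: "d \<in> \<rat>" "0 < d" "d < g x / 2" using Rats_dense_in_real[OF half_gt_zero[OF gx]] by blast
    have "d \<le> g y" if "a < y" "y \<le> b" for y
      using e(2)[of y] a b d that by (force simp: dist_real_def)
    then have "(a, b, d) \<in> J" using a b d by (auto simp: J_def)
    then show ?thesis using a b by force
  qed
  have "\<exists>z\<in>J. measure \<nu> {fst z<..fst (snd z)} \<noteq> 0"
  proof (rule ccontr)
    assume "\<not> ?thesis"
    then have "(\<Union>z\<in>J. {fst z<..fst (snd z)}) \<in> null_sets \<nu>"
      by (intro null_sets_UN' cJ) (auto simp: null_sets_def emeasure_eq_measure)
    then have "AE x in \<nu>. x \<notin> (\<Union>z\<in>J. {fst z<..fst (snd z)})" by (rule AE_not_in)
    then have "AE x in \<nu>. g x = 0"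
    proof eventually_elim
      case (elim x)
      then have "\<not> g x > 0" using cover[of x] by blast
      then show ?case using g(2)[of x] by simp
    qed
    then have "(\<integral>x. g x \<partial>\<nu>) = 0" by (rule integral_eq_zero_AE)
    with pos show False by simp
  qed
  then obtain a b \<delta> where J: "(a, b, \<delta>) \<in> J" and m: "measure \<nu> {a<..b} \<noteq> 0" by auto
  have "a < b" using J by (simp add: J_def)
  then have "cdf \<nu> b - cdf \<nu> a = measure \<nu> {a<..b}"
    by (rule finite_borel_measure.cdf_diff_eq[OF finite_borel_measure_M])
  then have "cdf \<nu> a < cdf \<nu> b" using m zero_less_measure_iff[of \<nu> "{a<..b}"] by linarith
  then show thesis using J by (intro that[of a b \<delta>]) (auto simp: J_def)
qed

text \<open>A single law on the line is always tight, so the finitely many early indices are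
  absorbed by enlarging the interval.\<close>

lemma tightI_eventually:
  assumes \<mu>: "\<And>n. real_distribution (\<mu> n)"
    and ev: "\<And>\<epsilon>. 0 < \<epsilon> \<Longrightarrow> \<exists>K N. \<forall>n\<ge>N. measure (\<mu> n) {-K..K} > 1 - \<epsilon>"
  shows "tight \<mu>"
  unfolding tight_def
proof (intro conjI allI impI \<mu>)
  fix \<epsilon> :: real assume \<epsilon>: "0 < \<epsilon>"
  then obtain K N where K: "\<And>n. n \<ge> N \<Longrightarrow> measure (\<mu> n) {-K..K} > 1 - \<epsilon>" using ev by blast
  have "\<exists>L. measure (\<mu> n) {-L..L} > 1 - \<epsilon>" for n
  proof -
    interpret real_distribution "\<mu> n" by (rule \<mu>)
    have "(\<lambda>i. measure (\<mu> n) {- real i..real i}) \<longlonglongrightarrow> measure (\<mu> n) (\<Union>i. {- real i..real i})"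
      by (rule finite_Lim_measure_incseq) (auto simp: incseq_def)
    also have "(\<Union>i. {- real i..real i}) = space (\<mu> n)"
    proof -
      have "\<exists>i. x \<in> {- real i..real i}" for x
      proof -
        obtain i where "\<bar>x\<bar> \<le> real i" using real_arch_simple by blast
        then show ?thesis by (intro exI[of _ i]) (auto simp: abs_le_iff)
      qed
      then show ?thesis by auto
    qed
    finally have "(\<lambda>i. measure (\<mu> n) {- real i..real i}) \<longlonglongrightarrow> 1" by (simp only: prob_space)
    then have "eventually (\<lambda>i. 1 - \<epsilon> < measure (\<mu> n) {- real i..real i}) sequentially"
      by (rule order_tendstoD) (use \<epsilon> in simp)
    then show ?thesis by (auto simp: eventually_sequentially)
  qed
  then obtain L where L: "\<And>n. measure (\<mu> n) {- L n..L n} > 1 - \<epsilon>" by metis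
  \<comment> \<open>The summand 1 makes the inequalities strict, so that the closed intervals fit
    into half-open ones.\<close>
  define R where "R = \<bar>K\<bar> + (\<Sum>n<N. \<bar>L n\<bar>) + 1"
  have R: "\<bar>K\<bar> < R" "n < N \<Longrightarrow> \<bar>L n\<bar> < R" for n
  proof -
    have s: "0 \<le> (\<Sum>n<N. \<bar>L n\<bar>)" by (intro sum_nonneg) auto
    show "\<bar>K\<bar> < R" unfolding R_def using s by linarith
    assume "n < N"
    then have "\<bar>L n\<bar> \<le> (\<Sum>n<N. \<bar>L n\<bar>)" by (intro member_le_sum) auto
    then show "\<bar>L n\<bar> < R" unfolding R_def by linarith
  qed
  show "\<exists>a b. a < b \<and> (\<forall>n. 1 - \<epsilon> < measure (\<mu> n) {a<..b})"
  proof (intro exI conjI allI)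
    show "- R < R" using R(1) by linarith
    fix n
    interpret real_distribution "\<mu> n" by (rule \<mu>)
    show "1 - \<epsilon> < measure (\<mu> n) {-R<..R}"
    proof (cases "n < N")
      case True
      have "measure (\<mu> n) {- L n..L n} \<le> measure (\<mu> n) {-R<..R}"
        using R(2)[OF True] by (intro finite_measure_mono) auto
      then show ?thesis using L[of n] by linarith
    next
      case False
      have "measure (\<mu> n) {- K..K} \<le> measure (\<mu> n) {-R<..R}"
        using R(1) by (intro finite_measure_mono) auto
      then show ?thesis using K[of n] False by linarith
    qed
  qed
qed

section \<open>Proxies\<close>

text \<open>The conclusions are the interface through which the final proof sees either proxy: a
  measurable array \<open>q\<close> with the same counts as the sorted \<psi>. Here \<open>q\<close>
  consists of the quantiles themselves and the last bound is the grid estimate, with nothing random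
  in it.\<close>

lemma (in prob_space) deterministic_proxy_count:
  assumes \<nu>: "real_distribution \<nu>" and \<psi>: "deterministic_proxy M (cdf \<nu>) \<psi>"
  obtains q :: "nat \<Rightarrow> nat \<Rightarrow> 'a \<Rightarrow> real" where
    "\<And>n k. k \<in> {1..n} \<Longrightarrow> q n k \<in> borel_measurable M"
    "\<And>n x. x \<in> space M \<Longrightarrow> mono_on {1..n} (\<lambda>k. \<psi> n k x)"
    "\<And>n x y. x \<in> space M \<Longrightarrow> count_le n (\<lambda>k. \<psi> n k x) y = count_le n (\<lambda>k. q n k x) y"
    "\<And>n y. 1 \<le> n \<Longrightarrow> expectation (\<lambda>x. \<bar>count_le n (\<lambda>k. q n k x) y - real n * cdf \<nu> y\<bar>) \<le>
       2 * sqrt (real n) * sqrt (cdf \<nu> y * (1 - cdf \<nu> y))"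
proof -
  interpret N: real_distribution \<nu> by fact
  define q where "q n k x = quantile (cdf \<nu>) (real k / (real n + 1))" for n k :: nat and x :: 'a
  have eq: "\<psi> n k x = q n k x" if "k \<in> {1..n}" "x \<in> space M" for n k x
    using \<psi> that by (simp add: deterministic_proxy_def q_def)
  have le: "q n k x \<le> y \<longleftrightarrow> real k / (real n + 1) \<le> cdf \<nu> y" if "k \<in> {1..n}" for n k x y
    unfolding q_def using that by (intro quantile_le_iff \<nu>) auto
  show thesis
  proof (rule that[of q])
    show "q n k \<in> borel_measurable M" for n k unfolding q_def[abs_def] by simp
    fix n x assume x: "x \<in> space M"
    show "mono_on {1..n} (\<lambda>k. \<psi> n k x)"
    proof (rule mono_onI)
      fix k l assume kl: "k \<in> {1..n}" "l \<in> {1..n}" "k \<le> l"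
      have "real k / (real n + 1) \<le> real l / (real n + 1)" using kl by (intro divide_right_mono) auto
      also have "\<dots> \<le> cdf \<nu> (q n l x)" using le[OF kl(2), of x "q n l x"] by simp
      finally have "q n k x \<le> q n l x" using le[OF kl(1)] by simp
      then show "\<psi> n k x \<le> \<psi> n l x" using eq kl x by simp
    qed
    show "count_le n (\<lambda>k. \<psi> n k x) y = count_le n (\<lambda>k. q n k x) y" for y
      unfolding count_le_def using eq x by (intro sum.cong) auto
  next
    fix n :: nat and y assume n: "1 \<le> n"
    have F: "0 \<le> cdf \<nu> y" "cdf \<nu> y \<le> 1"
      using N.cdf_bounded_prob finite_borel_measure.cdf_nonneg[OF N.finite_borel_measure_M] by auto
    have "count_le n (\<lambda>k. q n k x) y = (\<Sum>k=1..n. if real k / (real n + 1) \<le> cdf \<nu> y then 1 else 0)" for x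
      unfolding count_le_def using le by (intro sum.cong) (auto simp: indicator_def)
    then show "expectation (\<lambda>x. \<bar>count_le n (\<lambda>k. q n k x) y - real n * cdf \<nu> y\<bar>) \<le>
       2 * sqrt (real n) * sqrt (cdf \<nu> y * (1 - cdf \<nu> y))"
      using abs_grid_count_le[OF F n] by (simp add: prob_space)
  qed
qed

text \<open>Here \<open>q\<close> is the auxiliary sample before sorting: it has the same counts,
  and unlike the order statistics its entries are independent with a common law.\<close>

lemma (in prob_space) random_proxy_count:
  assumes \<nu>: "real_distribution \<nu>" and \<psi>: "random_proxy M (cdf \<nu>) X \<psi>"
  obtains q :: "nat \<Rightarrow> nat \<Rightarrow> 'a \<Rightarrow> real" where
    "\<And>n k. k \<in> {1..n} \<Longrightarrow> q n k \<in> borel_measurable M"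
    "\<And>n x. x \<in> space M \<Longrightarrow> mono_on {1..n} (\<lambda>k. \<psi> n k x)"
    "\<And>n x y. x \<in> space M \<Longrightarrow> count_le n (\<lambda>k. \<psi> n k x) y = count_le n (\<lambda>k. q n k x) y"
    "\<And>n y. 1 \<le> n \<Longrightarrow> expectation (\<lambda>x. \<bar>count_le n (\<lambda>k. q n k x) y - real n * cdf \<nu> y\<bar>) \<le>
       2 * sqrt (real n) * sqrt (cdf \<nu> y * (1 - cdf \<nu> y))"
proof -
  interpret N: real_distribution \<nu> by fact
  obtain q where indep: "\<And>n. indep_vars (\<lambda>_. borel) (q n) {1..n}"
    and law: "\<And>n k. k \<in> {1..n} \<Longrightarrow> cdf (distr M borel (q n k)) = cdf \<nu>"
    and eq: "\<And>n k x. k \<in> {1..n} \<Longrightarrow> x \<in> space M \<Longrightarrow> \<psi> n k x = increasing_rearrangement n (\<lambda>i. q n i x) k"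
    using \<psi> unfolding random_proxy_def by blast
  have meas: "q n k \<in> borel_measurable M" if "k \<in> {1..n}" for n k
    using indep[of n] that by (simp add: indep_vars_def)
  show thesis
  proof (rule that[of q])
    show "q n k \<in> borel_measurable M" if "k \<in> {1..n}" for n k by (rule meas[OF that])
    fix n x assume x: "x \<in> space M"
    show "mono_on {1..n} (\<lambda>k. \<psi> n k x)"
      using mono_on_increasing_rearrangement[of n "\<lambda>i. q n i x"] eq x by (simp add: mono_on_def)
    have "count_le n (\<lambda>k. \<psi> n k x) y = count_le n (increasing_rearrangement n (\<lambda>i. q n i x)) y" for y
      unfolding count_le_def using eq x by (intro sum.cong) auto
    then show "count_le n (\<lambda>k. \<psi> n k x) y = count_le n (\<lambda>k. q n k x) y" for y
      by (simp only: count_le_increasing_rearrangement)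
  next
    fix n :: nat and y assume n: "1 \<le> n"
    let ?u = "cdf \<nu> y"
    have F: "0 \<le> ?u" "?u \<le> 1"
      using N.cdf_bounded_prob finite_borel_measure.cdf_nonneg[OF N.finite_borel_measure_M] by auto
    have marg: "prob {x\<in>space M. q n k x \<le> y} = ?u" if k: "k \<in> {1..n}" for k
    proof -
      note [measurable] = meas[OF k]
      have "prob {x\<in>space M. q n k x \<le> y} = cdf (distr M borel (q n k)) y"
        unfolding cdf_def by (subst measure_distr) (auto intro!: arg_cong[where f = prob])
      then show ?thesis by (simp only: law[OF k])
    qed
    \<comment> \<open>Independence annihilates the off-diagonal covariances, so the double sum is
      \<open>n\<close>. The factor 2 gained at the end is slack that matches the deterministic
      proxy.\<close>
    have "expectation (\<lambda>x. \<bar>count_le n (\<lambda>k. q n k x) y - real n * ?u\<bar>) \<le>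
      sqrt ((\<Sum>i=1..n. \<Sum>j=1..n. if i = j then 1 else 0) * (?u * (1 - ?u)))"
    proof (rule expectation_abs_count_le[OF meas marg])
      fix i j assume ij: "i \<in> {1..n}" "j \<in> {1..n}"
      show "\<bar>prob {x\<in>space M. q n i x \<le> y \<and> q n j x \<le> y} - ?u\<^sup>2\<bar> \<le> (if i = j then 1 else 0) * (?u * (1 - ?u))"
      proof (cases "i = j")
        case True
        have "?u\<^sup>2 \<le> ?u" using F by (simp add: power2_eq_square mult_left_le)
        then show ?thesis using True marg[OF ij(1)] by (simp add: power2_eq_square algebra_simps)
      next
        case False
        have "prob (\<Inter>k\<in>{i, j}. q n k -` {..y} \<inter> space M) = (\<Prod>k\<in>{i, j}. prob (q n k -` {..y} \<inter> space M))"
          using ij by (intro indep_varsD[OF indep[of n]]) auto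
        moreover have "(\<Inter>k\<in>{i, j}. q n k -` {..y} \<inter> space M) = {x\<in>space M. q n i x \<le> y \<and> q n j x \<le> y}"
          by auto
        moreover have "q n k -` {..y} \<inter> space M = {x\<in>space M. q n k x \<le> y}" for k by auto
        ultimately show ?thesis using False marg ij by (simp add: power2_eq_square)
      qed
    qed auto
    also have "(\<Sum>i=1..n. \<Sum>j=1..n. if i = j then 1 else 0 :: real) = real n"
      by simp
    also have "sqrt (real n * (?u * (1 - ?u))) \<le> 2 * sqrt (real n) * sqrt (?u * (1 - ?u))"
      using F by (simp add: real_sqrt_mult)
    finally show "expectation (\<lambda>x. \<bar>count_le n (\<lambda>k. q n k x) y - real n * ?u\<bar>) \<le>
      2 * sqrt (real n) * sqrt (?u * (1 - ?u))" .
  qed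
qed

text \<open>The integrand is at most 1 on \<open>{-1..1}\<close>, and outside it the weight
  \<open>\<bar>x\<bar> ^ m\<close> is at least 1. The transport argument needs just the unweighted
  integral.\<close>

lemma nn_integral_sqrt_cdf_finite:
  assumes \<nu>: "real_distribution \<nu>"
    and fin: "(\<integral>\<^sup>+x. ennreal (\<bar>x\<bar> ^ m * sqrt (cdf \<nu> x * (1 - cdf \<nu> x))) \<partial>lborel) < \<infinity>"
  shows "(\<integral>\<^sup>+x. ennreal (sqrt (cdf \<nu> x * (1 - cdf \<nu> x))) \<partial>lborel) < \<infinity>"
proof -
  interpret cdf_distribution \<nu> using \<nu> by (simp add: cdf_distribution_def)
  let ?s = "\<lambda>x. sqrt (cdf \<nu> x * (1 - cdf \<nu> x))"
  have F: "0 \<le> cdf \<nu> x" "cdf \<nu> x \<le> 1" for x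
    using cdf_bounded_prob finite_borel_measure.cdf_nonneg[OF finite_borel_measure_M] by auto
  have s: "0 \<le> ?s x" "?s x \<le> 1" for x
    using F[of x] by (auto simp: mult_le_one)
  have "(\<integral>\<^sup>+x. ennreal (?s x) \<partial>lborel) \<le>
     (\<integral>\<^sup>+x. indicator {-1..1} x + ennreal (\<bar>x\<bar> ^ m * ?s x) \<partial>lborel)"
  proof (rule nn_integral_mono)
    fix x :: real
    show "ennreal (?s x) \<le> indicator {-1..1} x + ennreal (\<bar>x\<bar> ^ m * ?s x)"
    proof (cases "\<bar>x\<bar> \<le> 1")
      case True
      then have "ennreal (?s x) \<le> indicator {-1..1} x"
        using s[of x] by (simp add: indicator_def abs_le_iff ennreal_le_1)
      then show ?thesis by (rule order.trans) simp
    next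
      case False
      then have "1 * ?s x \<le> \<bar>x\<bar> ^ m * ?s x"
        using s[of x] by (intro mult_right_mono one_le_power) auto
      then have "ennreal (?s x) \<le> ennreal (\<bar>x\<bar> ^ m * ?s x)" by (intro ennreal_leI) simp
      then show ?thesis by (rule order.trans) simp
    qed
  qed
  also have "\<dots> = (\<integral>\<^sup>+x. indicator {-1..1::real} x \<partial>lborel) + (\<integral>\<^sup>+x. ennreal (\<bar>x\<bar> ^ m * ?s x) \<partial>lborel)"
    by (subst nn_integral_add) auto
  also have "\<dots> < \<infinity>" using fin by (simp add: ennreal_add_less_top less_top)
  finally show ?thesis .
qed

lemma measurable_p_norm:
  assumes "\<And>k. k \<in> {1..n} \<Longrightarrow> Y k \<in> borel_measurable M"
  shows "(\<lambda>x. p_norm p n (\<lambda>k. Y k x)) \<in> borel_measurable M"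
proof -
  have "(\<lambda>x. \<Sum>k=1..n. \<bar>Y k x\<bar> powr p) \<in> borel_measurable M"
  proof (rule borel_measurable_sum)
    fix k assume "k \<in> {1..n}"
    from assms[OF this] show "(\<lambda>x. \<bar>Y k x\<bar> powr p) \<in> borel_measurable M" by measurable
  qed
  then show ?thesis unfolding p_norm_def by measurable
qed

text \<open>Both sides are powers of \<open>D / n^2\<close>, with exponents 1/2 and 1/(2r). As the
  base is at most 1, the smaller exponent gives the larger value.\<close>

lemma rate_le:
  assumes n: "1 \<le> n" and D: "real n \<le> D" "D \<le> (real n)\<^sup>2" and r: "r \<in> {1, 2 :: nat}"
  shows "sqrt D / real n \<le> real n powr (- 1 / real r) * D powr (1 / (2 * real r))"
proof -
  have n0: "real n > 0" and D0: "D > 0" using n D by auto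
  define m where "m = D / (real n)\<^sup>2"
  have m: "0 < m" "m \<le> 1" using n0 D0 D by (auto simp: m_def)
  have rr: "real r \<ge> 1" using r by auto
  have "real n powr (- 1 / real r) * D powr (1 / (2 * real r)) = m powr (1 / (2 * real r))"
  proof -
    have "(real n)\<^sup>2 powr (1 / (2 * real r)) = real n powr (1 / real r)"
      using n0 rr by (simp add: powr_powr flip: powr_numeral)
    then show ?thesis using n0 D0 by (simp add: m_def powr_divide powr_minus divide_simps)
  qed
  moreover have "sqrt D / real n = m powr (1 / 2)"
    using n0 D0 by (simp add: m_def powr_half_sqrt real_sqrt_divide)
  moreover have "m powr (1 / 2) \<le> m powr (1 / (2 * real r))"
    using m rr by (intro powr_mono') (auto simp: divide_simps)
  ultimately show ?thesis by simp
qed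

section \<open>The rate of convergence\<close>

lemma (in prob_space) prob_count_le_deviation:
  assumes Z: "\<And>k. k \<in> {1..n} \<Longrightarrow> Z k \<in> borel_measurable M"
    and bd: "expectation (\<lambda>x. \<bar>count_le n (\<lambda>k. Z k x) y - c\<bar>) \<le> e" and d: "0 < d"
  shows "prob {x\<in>space M. d \<le> \<bar>count_le n (\<lambda>k. Z k x) y - c\<bar>} \<le> e / d"
proof -
  have "prob {x\<in>space M. d \<le> \<bar>count_le n (\<lambda>k. Z k x) y - c\<bar>} \<le>
      expectation (\<lambda>x. \<bar>count_le n (\<lambda>k. Z k x) y - c\<bar>) / d"
    by (rule integral_Markov_inequality_measure[OF integrable_count_le[OF Z] sets.empty_sets _ d]) auto
  also have "\<dots> \<le> e / d" using bd d by (intro divide_right_mono) auto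
  finally show ?thesis .
qed

text \<open>Triangle inequality through \<open>n * F\<close>, the expected distance bound for each
  sample, and Markov's inequality. No joint law of \<open>Z\<close> and \<open>Q\<close> is
  involved.\<close>

lemma (in prob_space) prob_count_le_distance:
  assumes Z: "\<And>k. k \<in> {1..n} \<Longrightarrow> Z k \<in> borel_measurable M"
    and Q: "\<And>k. k \<in> {1..n} \<Longrightarrow> Q k \<in> borel_measurable M"
    and [measurable]: "F \<in> borel_measurable borel" "g \<in> borel_measurable borel"
    and s: "0 \<le> s" "0 \<le> t"
    and bZ: "\<And>y. expectation (\<lambda>x. \<bar>count_le n (\<lambda>k. Z k x) y - real n * F y\<bar>) \<le> s * g y"
    and bQ: "\<And>y. expectation (\<lambda>x. \<bar>count_le n (\<lambda>k. Q k x) y - real n * F y\<bar>) \<le> t * g y"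
    and I: "(\<integral>\<^sup>+y. ennreal (g y) \<partial>lborel) = ennreal I" "0 \<le> I" and d: "0 < d"
  defines "T \<equiv> \<lambda>x. \<integral>\<^sup>+y. ennreal \<bar>count_le n (\<lambda>k. Z k x) y - count_le n (\<lambda>k. Q k x) y\<bar> \<partial>lborel"
  shows "T \<in> borel_measurable M" and "prob {x\<in>space M. ennreal d \<le> T x} \<le> (s + t) * I / d"
proof -
  note [measurable] = measurable_count_le_pair_lborel[OF Z] measurable_count_le_pair_lborel[OF Q]
  show T [measurable]: "T \<in> borel_measurable M"
  proof -
    have "(\<lambda>z. ennreal \<bar>count_le n (\<lambda>k. Z k (fst z)) (snd z) - count_le n (\<lambda>k. Q k (fst z)) (snd z)\<bar>)
        \<in> borel_measurable (M \<Otimes>\<^sub>M lborel)" by measurable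
    then show ?thesis
      unfolding T_def by (intro lborel.borel_measurable_nn_integral) (simp add: split_beta')
  qed
  have mI: "(\<lambda>x. \<integral>\<^sup>+y. ennreal \<bar>count_le n (\<lambda>k. Z k x) y - real n * F y\<bar> \<partial>lborel) \<in> borel_measurable M"
  proof -
    have "(\<lambda>z. ennreal \<bar>count_le n (\<lambda>k. Z k (fst z)) (snd z) - real n * F (snd z)\<bar>)
        \<in> borel_measurable (M \<Otimes>\<^sub>M lborel)" by measurable
    then show ?thesis by (intro lborel.borel_measurable_nn_integral) (simp add: split_beta')
  qed
  have mJ: "(\<lambda>x. \<integral>\<^sup>+y. ennreal \<bar>count_le n (\<lambda>k. Q k x) y - real n * F y\<bar> \<partial>lborel) \<in> borel_measurable M"
  proof -
    have "(\<lambda>z. ennreal \<bar>count_le n (\<lambda>k. Q k (fst z)) (snd z) - real n * F (snd z)\<bar>)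
        \<in> borel_measurable (M \<Otimes>\<^sub>M lborel)" by measurable
    then show ?thesis by (intro lborel.borel_measurable_nn_integral) (simp add: split_beta')
  qed
  have "T x \<le> (\<integral>\<^sup>+y. ennreal \<bar>count_le n (\<lambda>k. Z k x) y - real n * F y\<bar> \<partial>lborel) +
      (\<integral>\<^sup>+y. ennreal \<bar>count_le n (\<lambda>k. Q k x) y - real n * F y\<bar> \<partial>lborel)" for x
  proof -
    have "T x \<le> (\<integral>\<^sup>+y. ennreal \<bar>count_le n (\<lambda>k. Z k x) y - real n * F y\<bar> +
        ennreal \<bar>count_le n (\<lambda>k. Q k x) y - real n * F y\<bar> \<partial>lborel)"
      unfolding T_def
      by (rule nn_integral_mono) (auto simp flip: ennreal_plus intro!: ennreal_leI)
    also have "\<dots> = (\<integral>\<^sup>+y. ennreal \<bar>count_le n (\<lambda>k. Z k x) y - real n * F y\<bar> \<partial>lborel) +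
      (\<integral>\<^sup>+y. ennreal \<bar>count_le n (\<lambda>k. Q k x) y - real n * F y\<bar> \<partial>lborel)"
      by (rule nn_integral_add) measurable
    finally show ?thesis .
  qed
  then have "(\<integral>\<^sup>+x. T x \<partial>M) \<le> (\<integral>\<^sup>+x. (\<integral>\<^sup>+y. ennreal \<bar>count_le n (\<lambda>k. Z k x) y - real n * F y\<bar> \<partial>lborel) +
      (\<integral>\<^sup>+y. ennreal \<bar>count_le n (\<lambda>k. Q k x) y - real n * F y\<bar> \<partial>lborel) \<partial>M)"
    by (intro nn_integral_mono)
  also have "\<dots> = (\<integral>\<^sup>+x. \<integral>\<^sup>+y. ennreal \<bar>count_le n (\<lambda>k. Z k x) y - real n * F y\<bar> \<partial>lborel \<partial>M) +
      (\<integral>\<^sup>+x. \<integral>\<^sup>+y. ennreal \<bar>count_le n (\<lambda>k. Q k x) y - real n * F y\<bar> \<partial>lborel \<partial>M)"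
    by (rule nn_integral_add[OF mI mJ])
  also have "\<dots> \<le> ennreal s * ennreal I + ennreal t * ennreal I"
    unfolding I(1)[symmetric]
    by (intro add_mono nn_integral_count_le_dist Z Q bZ bQ s) auto
  also have "\<dots> = ennreal ((s + t) * I)"
    using s I(2) by (simp add: ennreal_mult distrib_right)
  finally have ET: "(\<integral>\<^sup>+x. T x \<partial>M) \<le> ennreal ((s + t) * I)" .
  have "emeasure M {x\<in>space M. 1 \<le> ennreal (1 / d) * T x} \<le> ennreal (1 / d) * (\<integral>\<^sup>+x. T x * indicator (space M) x \<partial>M)"
    by (rule nn_integral_Markov_inequality) auto
  also have "(\<integral>\<^sup>+x. T x * indicator (space M) x \<partial>M) = (\<integral>\<^sup>+x. T x \<partial>M)"
    by (intro nn_integral_cong) auto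
  also have "ennreal (1 / d) * (\<integral>\<^sup>+x. T x \<partial>M) \<le> ennreal (1 / d) * ennreal ((s + t) * I)"
    by (intro mult_left_mono ET) auto
  also have "\<dots> = ennreal ((s + t) * I / d)"
    using d s I(2) by (simp add: ennreal_mult[symmetric])
  finally have le: "emeasure M {x\<in>space M. 1 \<le> ennreal (1 / d) * T x} \<le> ennreal ((s + t) * I / d)" .
  have sub: "{x\<in>space M. ennreal d \<le> T x} \<subseteq> {x\<in>space M. 1 \<le> ennreal (1 / d) * T x}"
  proof safe
    fix x assume "ennreal d \<le> T x"
    then have "ennreal (1 / d) * ennreal d \<le> ennreal (1 / d) * T x" by (rule mult_left_mono) simp
    then show "1 \<le> ennreal (1 / d) * T x" using d by (simp add: ennreal_mult[symmetric])
  qed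
  have "{x\<in>space M. 1 \<le> ennreal (1 / d) * T x} \<in> sets M" by measurable
  from order.trans[OF emeasure_mono[OF sub this] le]
  have "emeasure M {x\<in>space M. ennreal d \<le> T x} \<le> ennreal ((s + t) * I / d)" .
  then show "prob {x\<in>space M. ennreal d \<le> T x} \<le> (s + t) * I / d"
    using d s I(2) by (simp add: emeasure_eq_measure)
qed

theorem corollary2p8:
  fixes M :: "'a measure" and \<nu> :: "real measure" and \<Psi> :: "real \<Rightarrow> real"
    and p \<sigma> :: real and r :: nat
    and W :: "nat \<Rightarrow> 'a \<Rightarrow> real"
    and X Y \<psi> :: "nat \<Rightarrow> nat \<Rightarrow> 'a \<Rightarrow> real"
    and \<Sigma>\<^sub>r :: "nat \<Rightarrow> 'a \<Rightarrow> real"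
    and \<omega> :: "real \<Rightarrow> real" and D :: "nat \<Rightarrow> real"
  assumes "prob_space M"
    and "p \<ge> 1" and "r \<in> {1, 2}" and "\<sigma> > 0"
    and "real_distribution \<nu>" and "\<Psi> = cdf \<nu>"
    and "(\<integral>\<^sup>+x. ennreal (\<bar>x\<bar> ^ (r - 1) * sqrt (\<Psi> x * (1 - \<Psi> x))) \<partial>lborel) < \<infinity>"
    and "gaussian_process M W" and "stationary_process M W"
    and "\<And>k. k \<ge> 1 \<Longrightarrow> prob_space.expectation M (W k) = 0"
    and "\<And>k. k \<ge> 1 \<Longrightarrow> prob_space.variance M (W k) = 1"
    and "\<And>n k. k \<in> {1..n} \<Longrightarrow> Y n k \<in> borel_measurable M"
    and "\<And>n k x. X n k x = Y n k x + \<sigma> * quantile \<Psi> (std_normal_cdf (W k x))"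
    and "\<And>n. D n = (\<Sum>i=1..n. \<Sum>j=1..n. \<bar>covariance M (W i) (W j)\<bar>)"
    and "deterministic_proxy M \<Psi> \<psi> \<or> random_proxy M \<Psi> X \<psi>"
    and "range \<omega> \<subseteq> {0..1}" and "continuous_on UNIV \<omega>"
    and "bdd_above (range (\<lambda>x. \<omega> x * \<bar>x\<bar> ^ r))"
    and "(\<integral>z. \<bar>z\<bar> ^ r * \<omega> z \<partial>\<nu>) > 0"
    and "\<And>n. \<Sigma>\<^sub>r n \<in> borel_measurable M"
    and "\<And>n. AE x in M. is_arg_min
           (\<lambda>s. \<Sum>k=1..n. \<omega> (\<psi> n k x) *
                  \<bar>increasing_rearrangement n (\<lambda>i. X n i x) k - s * \<psi> n k x\<bar> ^ r)
           (\<lambda>_. True) (\<Sigma>\<^sub>r n x)"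
  shows "bounded_in_probability M
           (\<lambda>n x. \<bar>\<Sigma>\<^sub>r n x - \<sigma>\<bar>)
           (\<lambda>n x. real n powr (- 1 / p) * p_norm p n (\<lambda>k. Y n k x)
                  + real n powr (- 1 / real r) * D n powr (1 / (2 * real r)))"
proof -
  interpret prob_space M by fact
  interpret N: real_distribution \<nu> by fact
  interpret standard_gaussian_process M W
    using assms(8,10,11) by unfold_locales auto
  note r = assms(3) and \<sigma> = assms(4) and \<nu> = assms(5) and \<Psi> = assms(6)

  \<comment> \<open>Fluctuation bounds for the Gaussian sample and the proxy\<close>
  define Z where "Z k x = quantile \<Psi> (std_normal_cdf (W k x))" for k x
  have X: "X n k x = Y n k x + \<sigma> * Z k x" for n k x using assms(13) by (simp add: Z_def)
  define F where "F y = cdf \<nu> y" for y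
  define g where "g y = sqrt (F y * (1 - F y))" for y
  have [measurable]: "F \<in> borel_measurable borel"
    unfolding F_def[abs_def] by (intro borel_measurable_mono monoI)
      (rule finite_borel_measure.cdf_nondecreasing[OF N.finite_borel_measure_M])
  have [measurable]: "g \<in> borel_measurable borel"
    unfolding g_def[abs_def] by measurable
  have F: "0 \<le> F y" "F y \<le> 1" for y
    unfolding F_def using N.cdf_bounded_prob finite_borel_measure.cdf_nonneg[OF N.finite_borel_measure_M] by auto
  have g01: "0 \<le> g y" "g y \<le> 1" for y
    using F[of y] by (auto simp: g_def mult_le_one)
  obtain I where I: "(\<integral>\<^sup>+y. ennreal (g y) \<partial>lborel) = ennreal I" "0 \<le> I"
  proof -
    have "(\<integral>\<^sup>+y. ennreal (g y) \<partial>lborel) < \<infinity>"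
      using nn_integral_sqrt_cdf_finite[OF \<nu>, of "r - 1"] assms(7) by (simp add: \<Psi> g_def F_def)
    then show ?thesis using that by (cases "\<integral>\<^sup>+y. ennreal (g y) \<partial>lborel") auto
  qed
  obtain q :: "nat \<Rightarrow> nat \<Rightarrow> 'a \<Rightarrow> real" where
    qm: "\<And>n k. k \<in> {1..n} \<Longrightarrow> q n k \<in> borel_measurable M" and
    mono: "\<And>n x. x \<in> space M \<Longrightarrow> mono_on {1..n} (\<lambda>k. \<psi> n k x)" and
    cnt: "\<And>n x y. x \<in> space M \<Longrightarrow> count_le n (\<lambda>k. \<psi> n k x) y = count_le n (\<lambda>k. q n k x) y" and
    bq: "\<And>n y. 1 \<le> n \<Longrightarrow> expectation (\<lambda>x. \<bar>count_le n (\<lambda>k. q n k x) y - real n * F y\<bar>) \<le>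
       2 * sqrt (real n) * g y"
  \<comment> \<open>The last point at which the two proxies are distinguished.\<close>
  proof (cases "deterministic_proxy M \<Psi> \<psi>")
    case True
    then show ?thesis
      using deterministic_proxy_count[OF \<nu>, of \<psi>] that unfolding \<Psi> g_def F_def by blast
  next
    case False
    then have "random_proxy M \<Psi> X \<psi>" using assms(15) by blast
    then show ?thesis
      using random_proxy_count[OF \<nu>, of X \<psi>] that unfolding \<Psi> g_def F_def by blast
  qed
  have Zm: "Z k \<in> borel_measurable M" if "k \<in> {1..n}" for k n
    unfolding Z_def[abs_def] \<Psi> using that by (intro measurable_quantile_component[OF \<nu>]) auto
  have Dn: "real n \<le> D n" "D n \<le> (real n)\<^sup>2" for n
    unfolding assms(14) by (rule covariance_sum_bounds)+
  have bZ: "expectation (\<lambda>x. \<bar>count_le n (\<lambda>k. Z k x) y - real n * F y\<bar>) \<le> 2 * sqrt (D n) * g y" for n y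
  proof -
    have "expectation (\<lambda>x. \<bar>count_le n (\<lambda>k. Z k x) y - real n * F y\<bar>) \<le>
      sqrt ((\<Sum>i=1..n. \<Sum>j=1..n. 2 * \<bar>covariance M (W i) (W j)\<bar>) * (F y * (1 - F y)))"
    proof (rule expectation_abs_count_le)
      show "k \<in> {1..n} \<Longrightarrow> Z k \<in> borel_measurable M" for k by (rule Zm)
      fix i assume i: "i \<in> {1..n}"
      then show "prob {x\<in>space M. Z i x \<le> y} = F y"
        unfolding Z_def F_def \<Psi> using quantile_component_cov(1)[OF \<nu>, of i i y] by simp
      fix j assume j: "j \<in> {1..n}"
      show "\<bar>prob {x\<in>space M. Z i x \<le> y \<and> Z j x \<le> y} - (F y)\<^sup>2\<bar> \<le>
          2 * \<bar>covariance M (W i) (W j)\<bar> * (F y * (1 - F y))"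
        unfolding Z_def F_def \<Psi> using i j by (intro quantile_component_cov(2)[OF \<nu>]) auto
    qed
    also have "(\<Sum>i=1..n. \<Sum>j=1..n. 2 * \<bar>covariance M (W i) (W j)\<bar>) = 2 * D n"
      unfolding assms(14) by (simp only: sum_distrib_left)
    also have "sqrt (2 * D n * (F y * (1 - F y))) = sqrt 2 * sqrt (D n) * g y"
      by (simp add: g_def real_sqrt_mult)
    also have "\<dots> \<le> 2 * sqrt (D n) * g y"
      using g01 Dn[of n] sqrt2_less_2 by (intro mult_right_mono) auto
    finally show ?thesis .
  qed

  \<comment> \<open>An interval that keeps the weighted moment of the proxy away from zero\<close>
  define G where "G x = \<bar>x\<bar> ^ r * \<omega> x" for x
  have \<omega>: "0 \<le> \<omega> x" "\<omega> x \<le> 1" for x using assms(16) by (auto simp: image_subset_iff)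
  have G0: "0 \<le> G x" for x using \<omega> by (simp add: G_def)
  have Gc: "continuous_on UNIV G"
    unfolding G_def by (intro continuous_intros assms(17))
  obtain a b \<delta> where ab: "a < b" "\<delta> > 0" "\<And>x. a < x \<Longrightarrow> x \<le> b \<Longrightarrow> \<delta> \<le> G x" "F a < F b"
    unfolding F_def by (rule ex_interval_lower_bound[OF \<nu> Gc G0]) (use assms(19) in \<open>auto simp: G_def\<close>)
  \<comment> \<open>A quarter of the mass of the interval: if the counts at both endpoints are off
    by less than \<open>n * \<eta>\<close>, at least \<open>2 * n * \<eta>\<close> proxy values
    still lie in the interval.\<close>
  define \<eta> where "\<eta> = (F b - F a) / 4"
  have \<eta>: "\<eta> > 0" using ab by (simp add: \<eta>_def)
  obtain B0 where B0: "\<And>x. \<omega> x * \<bar>x\<bar> ^ r \<le> B0"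
    using assms(18) by (auto simp: bdd_above_def)
  define B where "B = max 0 B0"
  have B: "0 \<le> B" "\<omega> x * \<bar>x\<bar> ^ r \<le> B" for x
    using B0[of x] by (auto simp: B_def)

  \<comment> \<open>The pathwise bound on the good event\<close>
  define T where "T n x = (\<integral>\<^sup>+y. ennreal \<bar>count_le n (\<lambda>k. Z k x) y - count_le n (\<lambda>k. q n k x) y\<bar> \<partial>lborel)" for n x
  define \<beta> where "\<beta> n x = real n powr (- 1 / p) * p_norm p n (\<lambda>k. Y n k x)
                  + real n powr (- 1 / real r) * D n powr (1 / (2 * real r))" for n x
  define \<zeta> where "\<zeta> n x = \<bar>\<Sigma>\<^sub>r n x - \<sigma>\<bar> / \<beta> n x" for n x
  have \<zeta>m [measurable]: "\<zeta> n \<in> borel_measurable M" for n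
  proof -
    have [measurable]: "(\<lambda>x. p_norm p n (\<lambda>k. Y n k x)) \<in> borel_measurable M" "\<Sigma>\<^sub>r n \<in> borel_measurable M"
      using assms(12,20) by (auto intro!: measurable_p_norm)
    show ?thesis unfolding \<zeta>_def[abs_def] \<beta>_def by measurable
  qed
  \<comment> \<open>The numerator collects \<open>2 + B\<close> from the comparison of losses and
    \<open>1 + \<sigma> * \<tau>\<close> from \<open>Y\<close> and the transport distance; the
    denominator is the lower bound for the weighted moment divided by \<open>n\<close>.\<close>
  define K where "K \<tau> = (2 + B) * (1 + \<sigma> * \<tau>) / (2 * \<delta> * \<eta>)" for \<tau>
  \<comment> \<open>A statement about a single outcome \<open>x\<close>, so the randomness of the
    normalisation \<beta> does no harm.\<close>
  have bound: "\<bar>\<zeta> n x\<bar> \<le> K \<tau>"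
    if n: "1 \<le> n" and \<tau>: "0 \<le> \<tau>" and x: "x \<in> space M"
      and amin: "is_arg_min (\<lambda>s. \<Sum>k=1..n. \<omega> (\<psi> n k x) *
                  \<bar>increasing_rearrangement n (\<lambda>i. X n i x) k - s * \<psi> n k x\<bar> ^ r) (\<lambda>_. True) (\<Sigma>\<^sub>r n x)"
      and ca: "\<bar>count_le n (\<lambda>k. q n k x) a - real n * F a\<bar> < real n * \<eta>"
      and cb: "\<bar>count_le n (\<lambda>k. q n k x) b - real n * F b\<bar> < real n * \<eta>"
      and cT: "T n x < ennreal (\<tau> * sqrt (D n))" for n \<tau> x
  proof -
    let ?\<psi> = "\<lambda>k. \<psi> n k x"
    have n0: "real n > 0" using n by simp
    have D0: "D n > 0" using Dn(1)[of n] n by linarith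
    define A where "A = (\<Sum>k=1..n. \<omega> (?\<psi> k) * \<bar>?\<psi> k\<bar> ^ r)"
    define R where "R = (\<Sum>k=1..n. \<bar>increasing_rearrangement n (\<lambda>i. X n i x) k - \<sigma> * ?\<psi> k\<bar>)"
    define y where "y = (\<Sum>k=1..n. \<bar>Y n k x\<bar>)"
    have y0: "0 \<le> y" unfolding y_def by (intro sum_nonneg) auto
    have est: "\<bar>\<Sigma>\<^sub>r n x - \<sigma>\<bar> * A \<le> (2 + B) * R"
      unfolding A_def R_def
      by (rule arg_min_weighted_power_dist[OF r]) (use \<omega> B amin in auto)
    have "ennreal R \<le> ennreal y + ennreal \<sigma> * (\<integral>\<^sup>+v. ennreal \<bar>count_le n (\<lambda>k. Z k x) v - count_le n ?\<psi> v\<bar> \<partial>lborel)"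
      unfolding R_def y_def by (rule sum_abs_rearrangement_proxy_le[OF mono[OF x] \<sigma> X])
    also have "(\<integral>\<^sup>+v. ennreal \<bar>count_le n (\<lambda>k. Z k x) v - count_le n ?\<psi> v\<bar> \<partial>lborel) = T n x"
      by (simp only: T_def cnt[OF x])
    also have "ennreal y + ennreal \<sigma> * T n x \<le> ennreal y + ennreal \<sigma> * ennreal (\<tau> * sqrt (D n))"
      using cT by (intro add_left_mono mult_left_mono) auto
    also have "\<dots> = ennreal (y + \<sigma> * (\<tau> * sqrt (D n)))"
      using \<sigma> \<tau> D0 y0 by (simp add: ennreal_mult[symmetric] ennreal_plus[symmetric] del: ennreal_plus)
    finally have R: "R \<le> y + \<sigma> * (\<tau> * sqrt (D n))"
      using \<sigma> \<tau> D0 y0 by (subst (asm) ennreal_le_iff) auto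
    \<comment> \<open>Each proxy value in the half-open interval from \<open>a\<close> to
      \<open>b\<close> contributes at least \<delta> to \<open>A\<close>, all others at least
      0.\<close>
    have "\<delta> * (2 * real n * \<eta>) \<le> \<delta> * (count_le n ?\<psi> b - count_le n ?\<psi> a)"
    proof (rule mult_left_mono)
      have "real n * F b - real n * F a = 4 * (real n * \<eta>)" by (simp add: \<eta>_def right_diff_distrib)
      then show "2 * real n * \<eta> \<le> count_le n ?\<psi> b - count_le n ?\<psi> a"
        using ca cb unfolding cnt[OF x] by linarith
    qed (use ab in simp)
    also have "\<dots> = (\<Sum>k=1..n. \<delta> * (indicat_real {..b} (?\<psi> k) - indicat_real {..a} (?\<psi> k)))"
      by (simp only: count_le_def sum_subtractf[symmetric] sum_distrib_left)
    also have "\<dots> \<le> A"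
      unfolding A_def
    proof (rule sum_mono)
      fix k
      show "\<delta> * (indicat_real {..b} (?\<psi> k) - indicat_real {..a} (?\<psi> k)) \<le> \<omega> (?\<psi> k) * \<bar>?\<psi> k\<bar> ^ r"
        using ab(1) ab(3)[of "?\<psi> k"] G0[of "?\<psi> k"] by (auto simp: indicator_def G_def mult.commute)
    qed
    finally have A: "2 * \<delta> * \<eta> * real n \<le> A" by (simp add: mult_ac)
    have "\<bar>\<Sigma>\<^sub>r n x - \<sigma>\<bar> * (2 * \<delta> * \<eta> * real n) \<le> \<bar>\<Sigma>\<^sub>r n x - \<sigma>\<bar> * A"
      by (intro mult_left_mono A) simp
    also note est
    also have "(2 + B) * R \<le> (2 + B) * (y + \<sigma> * (\<tau> * sqrt (D n)))"
      using B(1) by (intro mult_left_mono R) simp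
    also have "\<dots> = (2 + B) * (y / real n + \<sigma> * \<tau> * (sqrt (D n) / real n)) * real n"
      using n0 by (simp add: field_simps)
    finally have "\<bar>\<Sigma>\<^sub>r n x - \<sigma>\<bar> * (2 * \<delta> * \<eta>) * real n \<le> (2 + B) * (y / real n + \<sigma> * \<tau> * (sqrt (D n) / real n)) * real n"
      by (simp only: mult.assoc)
    then have 1: "\<bar>\<Sigma>\<^sub>r n x - \<sigma>\<bar> * (2 * \<delta> * \<eta>) \<le> (2 + B) * (y / real n + \<sigma> * \<tau> * (sqrt (D n) / real n))"
      using n0 by (rule mult_right_le_imp_le)
    have y\<beta>: "y / real n + sqrt (D n) / real n \<le> \<beta> n x"
      unfolding \<beta>_def y_def
      by (intro add_mono mean_abs_le_p_norm rate_le assms(2) n Dn r)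
    have pos: "0 \<le> y / real n" "0 < sqrt (D n) / real n" using y0 n0 D0 by auto
    then have \<beta>0: "\<beta> n x > 0" using y\<beta> by linarith
    have "y / real n + \<sigma> * \<tau> * (sqrt (D n) / real n) \<le> (1 + \<sigma> * \<tau>) * (y / real n + sqrt (D n) / real n)"
    proof -
      have "0 \<le> \<sigma> * \<tau> * (y / real n)" using pos \<sigma> \<tau> by (intro mult_nonneg_nonneg) auto
      then show ?thesis using pos(2) by (simp only: distrib_left distrib_right mult_1)
    qed
    also have "\<dots> \<le> (1 + \<sigma> * \<tau>) * \<beta> n x"
      using \<sigma> \<tau> by (intro mult_left_mono y\<beta>) auto
    finally have "(2 + B) * (y / real n + \<sigma> * \<tau> * (sqrt (D n) / real n)) \<le> (2 + B) * ((1 + \<sigma> * \<tau>) * \<beta> n x)"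
      using B(1) by (intro mult_left_mono) auto
    with 1 have "\<bar>\<Sigma>\<^sub>r n x - \<sigma>\<bar> * (2 * \<delta> * \<eta>) \<le> (2 + B) * (1 + \<sigma> * \<tau>) * \<beta> n x" by (simp only: mult.assoc)
    then have "\<bar>\<Sigma>\<^sub>r n x - \<sigma>\<bar> / \<beta> n x \<le> K \<tau>"
      using \<beta>0 ab(2) \<eta> unfolding K_def by (simp add: pos_divide_le_eq pos_le_divide_eq mult_ac)
    then show ?thesis using \<beta>0 by (simp add: \<zeta>_def)
  qed

  \<comment> \<open>Probability of the good event and tightness\<close>
  have "tight (\<lambda>n. distr M borel (\<zeta> n))"
  proof (rule tightI_eventually)
    show "real_distribution (distr M borel (\<zeta> n))" for n by (rule real_distribution_distr) measurable
    fix \<epsilon> :: real assume \<epsilon>: "0 < \<epsilon>"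
    \<comment> \<open>By Markov's inequality the transport event will have probability at most
      \<open>4 * I / \<tau>\<close>, which has to stay below half of \<epsilon>; the summand 1 keeps
      \<tau> positive when \<open>I = 0\<close> and makes the inequality strict.\<close>
    define \<tau> where "\<tau> = 8 * I / \<epsilon> + 1"
    have \<tau>: "\<tau> > 0" using I(2) \<epsilon> by (simp add: \<tau>_def add_nonneg_pos)
    have \<tau>I: "4 * I / \<tau> < \<epsilon> / 2" using \<tau> \<epsilon> I(2) by (simp add: \<tau>_def field_simps)
    \<comment> \<open>Twice the Chebyshev-type bound \<open>2 / (\<eta> * sqrt (real n))\<close> for
      the count at one endpoint. It is below half of \<epsilon> only for large \<open>n\<close>,
      whence the eventual form of the tightness criterion.\<close>
    have "(\<lambda>n. 4 / (\<eta> * sqrt (real n))) \<longlonglongrightarrow> 0"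
      by (intro real_tendsto_divide_at_top[OF tendsto_const] filterlim_tendsto_pos_mult_at_top[OF tendsto_const \<eta>]
          filterlim_compose[OF sqrt_at_top filterlim_real_sequentially])
    then have "eventually (\<lambda>n. 4 / (\<eta> * sqrt (real n)) < \<epsilon> / 2) sequentially"
      using \<epsilon> by (intro order_tendstoD(2)) auto
    then obtain N0 where N0: "\<And>n. n \<ge> N0 \<Longrightarrow> 4 / (\<eta> * sqrt (real n)) < \<epsilon> / 2"
      by (auto simp: eventually_sequentially)
    have "measure (distr M borel (\<zeta> n)) {- K \<tau>..K \<tau>} > 1 - \<epsilon>" if nN: "n \<ge> max 1 N0" for n
    proof -
      have n: "1 \<le> n" using nN by simp
      then have n0: "real n > 0" by simp
      have D0: "D n > 0" using Dn(1)[of n] n0 by linarith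
      have sD: "sqrt (real n) \<le> sqrt (D n)" using Dn(1)[of n] by simp
      define E1 where "E1 = {x\<in>space M. real n * \<eta> \<le> \<bar>count_le n (\<lambda>k. q n k x) a - real n * F a\<bar>}"
      define E2 where "E2 = {x\<in>space M. real n * \<eta> \<le> \<bar>count_le n (\<lambda>k. q n k x) b - real n * F b\<bar>}"
      define E3 where "E3 = {x\<in>space M. ennreal (\<tau> * sqrt (D n)) \<le> T n x}"
      have dev: "prob {x\<in>space M. real n * \<eta> \<le> \<bar>count_le n (\<lambda>k. q n k x) v - real n * F v\<bar>} \<le> 2 / (\<eta> * sqrt (real n))" for v
      proof -
        have "2 * sqrt (real n) * g v \<le> 2 * sqrt (real n) * 1" using g01 by (intro mult_left_mono) auto
        with bq[OF n, of v] have "expectation (\<lambda>x. \<bar>count_le n (\<lambda>k. q n k x) v - real n * F v\<bar>) \<le> 2 * sqrt (real n)"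
          by simp
        from prob_count_le_deviation[where d = "real n * \<eta>", OF qm this]
        have "prob {x\<in>space M. real n * \<eta> \<le> \<bar>count_le n (\<lambda>k. q n k x) v - real n * F v\<bar>} \<le> 2 * sqrt (real n) / (real n * \<eta>)"
          using n0 \<eta> by simp
        also have "\<dots> = 2 / (\<eta> * sqrt (real n))"
          using n0 \<eta> by (simp add: field_simps)
        finally show ?thesis .
      qed
      have T': "T n \<in> borel_measurable M" "prob E3 \<le> (2 * sqrt (D n) + 2 * sqrt (real n)) * I / (\<tau> * sqrt (D n))"
        unfolding E3_def T_def[abs_def]
        by (rule prob_count_le_distance[where F = F and g = g and s = "2 * sqrt (D n)" and t = "2 * sqrt (real n)" and I = I and d = "\<tau> * sqrt (D n)"];
          use Zm qm bZ bq[OF n] I \<tau> D0 n0 in auto)+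
      \<comment> \<open>The proxy term is absorbed through \<open>real n \<le> D n\<close>, after
        which the bound no longer depends on \<open>n\<close>.\<close>
      have "(2 * sqrt (D n) + 2 * sqrt (real n)) * I / (\<tau> * sqrt (D n)) \<le> (4 * sqrt (D n)) * I / (\<tau> * sqrt (D n))"
        using sD I(2) \<tau> D0 by (intro divide_right_mono mult_right_mono) auto
      also have "\<dots> = 4 * I / \<tau>" using D0 by simp
      finally have p3: "prob E3 < \<epsilon> / 2" using T'(2) \<tau>I by linarith
      define h where "h v x = \<bar>count_le n (\<lambda>k. q n k x) v - real n * F v\<bar>" for v x
      have [measurable]: "h v \<in> borel_measurable M" for v
        unfolding h_def[abs_def]
        by (intro borel_measurable_abs borel_measurable_diff borel_measurable_const measurable_count_le_at qm)
      note [measurable] = T'(1)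
      have "{x\<in>space M. real n * \<eta> \<le> h v x} \<in> sets M" for v by measurable
      moreover have "E3 \<in> sets M" unfolding E3_def by measurable
      ultimately have Em: "E1 \<in> sets M" "E2 \<in> sets M" "E3 \<in> sets M"
        unfolding E1_def E2_def h_def by blast+
      have "prob (E1 \<union> E2 \<union> E3) \<le> prob (E1 \<union> E2) + prob E3"
        using Em by (intro measure_Un_le) auto
      also have "prob (E1 \<union> E2) \<le> prob E1 + prob E2" using Em by (intro measure_Un_le) auto
      finally have "prob (E1 \<union> E2 \<union> E3) \<le> 2 * (2 / (\<eta> * sqrt (real n))) + prob E3"
        using dev[of a] dev[of b] unfolding E1_def E2_def by linarith
      also have "\<dots> < \<epsilon>" using p3 N0[of n] nN by simp
      finally have "1 - \<epsilon> < prob (space M - (E1 \<union> E2 \<union> E3))"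
        using Em by (subst prob_compl) auto
      also have "\<dots> \<le> prob (\<zeta> n -` {- K \<tau>..K \<tau>} \<inter> space M)"
      proof (rule finite_measure_mono_AE)
        show "AE x in M. x \<in> space M - (E1 \<union> E2 \<union> E3) \<longrightarrow> x \<in> \<zeta> n -` {- K \<tau>..K \<tau>} \<inter> space M"
          using assms(21)[of n]
        proof eventually_elim
          case (elim x)
          show ?case
          proof
            assume x: "x \<in> space M - (E1 \<union> E2 \<union> E3)"
            have "\<bar>\<zeta> n x\<bar> \<le> K \<tau>"
              using x \<tau> by (intro bound[OF n _ _ elim]) (auto simp: E1_def E2_def E3_def not_le)
            then show "x \<in> \<zeta> n -` {- K \<tau>..K \<tau>} \<inter> space M" using x by (auto simp: abs_le_iff)
          qed
        qed
      qed measurable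
      also have "\<dots> = measure (distr M borel (\<zeta> n)) {- K \<tau>..K \<tau>}"
        by (subst measure_distr) auto
      finally show ?thesis .
    qed
    then show "\<exists>K N. \<forall>n\<ge>N. measure (distr M borel (\<zeta> n)) {-K..K} > 1 - \<epsilon>"
      by blast
  qed
  then show ?thesis
    unfolding bounded_in_probability_def \<zeta>_def[abs_def] \<beta>_def .
qed

end
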